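(* Let $C\subset\mathbb{R}^2$ be any simple closed curve with geometric dilation $\delta(C)\le(1+\varepsilon)\pi/2$ for $\varepsilon\le 0.0001$. Then $C$ can be enclosed in a $(1+3\sqrt{\varepsilon})$-ring. This bound cannot be improved apart from the coefficient of $\sqrt{\varepsilon}$.
   Context: Curves are assumed to be piecewise continuously differentiable. A closed curve is simple if it has no self-intersections. For a simple closed curve $C$ and points $p\neq q$ on $C$, $d_C(p,q)$ denotes the length of a shortest path on $C$ connecting $p$ and $q$ (the shorter of the two arcs of $C$ between them), and $|pq|$ denotes the Euclidean distance. The geometric dilation of $C$ is $\delta(C)=\sup_{p,q\in C,\,p\neq q} d_C(p,q)/|pq|$. An $\eta$-ring is the closed region between two concentric circles where the outer radius equals $\eta$ times the inner radius. *)

theory Defs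
  imports "HOL-Analysis.Analysis"
begin

text \<open>
  The library's \<open>valid_path\<close> puts no condition on the derivative near a breakpoint, so such a
  path may have infinite length (\<open>t sin (1/t)\<close> at \<open>0\<close>). Here the path must be continuously
  differentiable on each closed piece, with one-sided derivatives at the breakpoints. Derivatives
  may vanish.
\<close>

definition piecewise_C1_path :: "(real \<Rightarrow> real^2) \<Rightarrow> bool" where
  "piecewise_C1_path g \<longleftrightarrow> path g \<and>
    (\<exists>S. finite S \<and> {0, 1} \<subseteq> S \<and> S \<subseteq> {0..1} \<and>
      (\<forall>a\<in>S. \<forall>b\<in>S. a < b \<and> {a<..<b} \<inter> S = {} \<longrightarrow>
        (\<exists>D. continuous_on {a..b} D \<and>
          (\<forall>t\<in>{a..b}. (g has_vector_derivative D t) (at t within {a..b})))))"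

definition simple_closed_curve :: "(real \<Rightarrow> real^2) \<Rightarrow> bool" where
  "simple_closed_curve g \<longleftrightarrow>
    piecewise_C1_path g \<and> simple_path g \<and> pathfinish g = pathstart g"

text \<open>Two-sided derivatives suffice below: they exist off the finitely many breakpoints.\<close>

definition arc_length :: "(real \<Rightarrow> real^2) \<Rightarrow> real \<Rightarrow> real \<Rightarrow> real" where
  "arc_length g a b = integral {a..b} (\<lambda>t. norm (vector_derivative g (at t)))"

text \<open>A simple closed curve is injective on \<open>{0..<1}\<close> and maps it onto its image.\<close>

definition curve_param :: "(real \<Rightarrow> real^2) \<Rightarrow> real^2 \<Rightarrow> real" where
  "curve_param g p = the_inv_into {0..<1} g p"

text \<open>Length of the shorter of the two arcs; the second one passes through \<open>g 0 = g 1\<close>.\<close>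

definition curve_dist :: "(real \<Rightarrow> real^2) \<Rightarrow> real^2 \<Rightarrow> real^2 \<Rightarrow> real" where
  "curve_dist g p q =
    (let s = min (curve_param g p) (curve_param g q);
         t = max (curve_param g p) (curve_param g q)
     in min (arc_length g s t) (arc_length g t 1 + arc_length g 0 s))"

text \<open>Extended real, since the dilation is infinite for a curve with a cusp.\<close>

definition dilation :: "(real \<Rightarrow> real^2) \<Rightarrow> ereal" where
  "dilation g =
    (SUP (p, q) \<in> {(p, q). p \<in> path_image g \<and> q \<in> path_image g \<and> p \<noteq> q}.
       ereal (curve_dist g p q / dist p q))"

text \<open>Closed region between the circles of radii \<open>r\<close> and \<open>\<eta> * r\<close> about \<open>z\<close>.\<close>

definition eta_ring :: "real \<Rightarrow> real^2 \<Rightarrow> real \<Rightarrow> (real^2) set" where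
  "eta_ring \<eta> z r = {x. r \<le> dist z x \<and> dist z x \<le> \<eta> * r}"

text \<open>
  The curve has to go around the hole of the ring. Containment alone would be vacuous: for
  \<open>\<eta> > 1\<close> every bounded set lies in some \<open>\<eta>\<close>-ring with \<open>r\<close> large, off to one side.
\<close>

definition enclosed_in_ring :: "(real \<Rightarrow> real^2) \<Rightarrow> real \<Rightarrow> bool" where
  "enclosed_in_ring g \<eta> \<longleftrightarrow>
    (\<exists>z r. r > 0 \<and> path_image g \<subseteq> eta_ring \<eta> z r \<and> ball z r \<subseteq> inside (path_image g))"

end

theory Submission
  imports Defs "HOL-Complex_Analysis.Complex_Analysis"
begin

text \<open>
  Parametrise the curve by arc length and split it into its midpoint curve \<open>m\<close> and its
  half-difference curve \<open>w\<close>, with \<open>w\<close> antiperiodic over half a period. Small dilation forces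
  \<open>\<bar>w\<bar> \<ge> \<rho>\<close>, where \<open>2 \<pi> \<rho>\<close> is the length up to the factor \<open>1 + \<epsilon>\<close>. The parallelogram law gives
  \<open>\<bar>m'\<bar>\<^sup>2 + \<bar>w'\<bar>\<^sup>2 \<le> L\<^sup>2\<close>, and \<open>w\<close>, turning by at least \<open>\<pi>\<close> in half a period outside the disc of
  radius \<open>\<rho>\<close>, uses up almost all of the length. What is left keeps \<open>m\<close> within \<open>O(\<surd>\<epsilon>)\<close> of a point
  \<open>z\<close> and \<open>\<bar>w\<bar>\<close> below \<open>(1 + O(\<surd>\<epsilon>)) \<rho>\<close>, so the curve \<open>m + w\<close> lies in a thin ring about \<open>z\<close>.

  Conversely, a circle whose centre moves by \<open>O(\<surd>\<epsilon>)\<close> radially, with period \<open>\<pi>\<close>, has dilation at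
  most \<open>(1 + \<epsilon>) \<pi>/2\<close>, because its length grows only by the factor \<open>1 + O(\<epsilon>)\<close>.
\<close>

section \<open>Curves with large halving distance\<close>

text \<open>The law of cosines, arranged by the half-angle formula into a radial and an angular
  part. Dropping the radial part bounds turning by chords; \<open>r = s = 1\<close> gives the chords
  of the unit circle.\<close>

lemma cmod_diff_polar:
  "(cmod (of_real r * cis a - of_real s * cis b))\<^sup>2 = (r - s)\<^sup>2 + 4 * r * s * (sin ((a - b) / 2))\<^sup>2"
proof -
  have "(cmod (of_real r * cis a - of_real s * cis b))\<^sup>2
      = (r * cos a - s * cos b)\<^sup>2 + (r * sin a - s * sin b)\<^sup>2"
    by (simp add: cmod_power2)
  also have "\<dots> = r\<^sup>2 * ((sin a)\<^sup>2 + (cos a)\<^sup>2) + s\<^sup>2 * ((sin b)\<^sup>2 + (cos b)\<^sup>2)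
      - 2 * r * s * (cos a * cos b + sin a * sin b)"
    by algebra
  also have "\<dots> = r\<^sup>2 + s\<^sup>2 - 2 * r * s * cos (2 * ((a - b) / 2))"
    by (simp only: mult_2 field_sum_of_halves cos_diff sin_cos_squared_add3 sin_cos_squared_add mult_1_right)
  also have "\<dots> = (r - s)\<^sup>2 + 4 * r * s * (sin ((a - b) / 2))\<^sup>2"
    by (simp only: cos_double_sin) algebra
  finally show ?thesis .
qed

text \<open>Arc and chord agree to first order at 0; any factor \<open>k\<close> below 1 absorbs the
  error.\<close>

lemma eventually_sin_ge:
  fixes k :: real
  assumes "k < 1"
  shows "\<forall>\<^sub>F x in nhds 0. k * \<bar>x\<bar> \<le> \<bar>sin x\<bar>"
proof -
  have "((\<lambda>x::real. sin x / x) \<longlongrightarrow> 1) (at 0)"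
    using DERIV_sin[of 0] by (simp add: has_field_derivative_iff)
  then have "\<forall>\<^sub>F x::real in at 0. k < sin x / x"
    using assms by (rule order_tendstoD)
  then show ?thesis
    unfolding eventually_at_filter
  proof (rule eventually_mono)
    fix x :: real
    assume *: "x \<noteq> 0 \<longrightarrow> x \<in> UNIV \<longrightarrow> k < sin x / x"
    show "k * \<bar>x\<bar> \<le> \<bar>sin x\<bar>"
    proof (cases "x = 0")
      case False
      with * have "k < sin x / x" by simp
      also have "\<dots> \<le> \<bar>sin x\<bar> / \<bar>x\<bar>" by (metis abs_divide abs_ge_self)
      finally show ?thesis using False by (simp add: field_simps)
    qed simp
  qed
qed

text \<open>Models a curve traversed at constant speed with period 1: \<open>L\<close> plays the
  role of its length, and parameters differing by \<open>1/2\<close> give the halving pairs. The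
  Lipschitz bound replaces derivatives, so the estimates below concern increments.\<close>

locale halving_curve =
  fixes \<gamma> :: "real \<Rightarrow> complex" and L \<rho> :: real
  assumes periodic: "\<gamma> (x + 1) = \<gamma> x"
    and lipschitz: "cmod (\<gamma> x - \<gamma> y) \<le> L * \<bar>x - y\<bar>"
    and halving: "2 * \<rho> \<le> cmod (\<gamma> x - \<gamma> (x + 1/2))"
    and \<rho>_pos: "0 < \<rho>"
begin

definition m where "m x = (\<gamma> x + \<gamma> (x + 1/2)) / 2"
definition w where "w x = (\<gamma> x - \<gamma> (x + 1/2)) / 2"

lemma \<gamma>_eq: "\<gamma> x = m x + w x"
  by (simp add: m_def w_def field_simps)

lemma m_half: "m (x + 1/2) = m x" and w_half: "w (x + 1/2) = - w x"
  using periodic[of x] by (simp_all add: m_def w_def add.assoc add.commute[of "\<gamma> x"] minus_divide_left)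

lemma L_nonneg: "0 \<le> L"
  using lipschitz[of 1 0] norm_ge_zero[of "\<gamma> 1 - \<gamma> 0"] by (simp del: norm_ge_zero)

lemma continuous_\<gamma>: "continuous_on S \<gamma>"
  by (rule continuous_on_subset[OF _ subset_UNIV], rule lipschitz_on_continuous_on[of L])
     (auto intro!: lipschitz_onI simp: dist_norm lipschitz L_nonneg)

lemma continuous_w: "continuous_on S w"
  unfolding w_def
  by (intro continuous_intros continuous_\<gamma> continuous_on_compose2[OF continuous_\<gamma> _ subset_UNIV]) simp

lemma w_ge: "\<rho> \<le> cmod (w x)"
  using halving[of x] by (simp add: w_def norm_divide)

text \<open>The parallelogram law for the increments of \<gamma> at the two points of a halving
  pair, each at most \<open>L * \<bar>x - y\<bar>\<close>.\<close>

lemma speed: "(cmod (m x - m y))\<^sup>2 + (cmod (w x - w y))\<^sup>2 \<le> (L * (x - y))\<^sup>2"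
proof -
  define a b where "a = \<gamma> x - \<gamma> y" and "b = \<gamma> (x + 1/2) - \<gamma> (y + 1/2)"
  have m: "m x - m y = (a + b) / 2" and w: "w x - w y = (a - b) / 2"
    by (simp_all add: m_def w_def a_def b_def field_simps)
  have ab: "cmod a \<le> \<bar>L * (x - y)\<bar>" "cmod b \<le> \<bar>L * (x - y)\<bar>"
    using lipschitz[of x y] lipschitz[of "x + 1/2" "y + 1/2"] L_nonneg
    by (simp_all add: a_def b_def abs_mult)
  have "(cmod (m x - m y))\<^sup>2 + (cmod (w x - w y))\<^sup>2 = ((cmod a)\<^sup>2 + (cmod b)\<^sup>2) / 2"
    unfolding m w by (simp add: norm_divide cmod_power2 power_divide) (simp add: power2_eq_square field_simps)
  also have "\<dots> \<le> (L * (x - y))\<^sup>2"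
    using power_mono[OF ab(1), of 2] power_mono[OF ab(2), of 2] by simp
  finally show ?thesis .
qed

lemma w_lipschitz: "cmod (w x - w y) \<le> L * \<bar>x - y\<bar>"
proof -
  have "(cmod (w x - w y))\<^sup>2 \<le> (L * \<bar>x - y\<bar>)\<^sup>2"
    unfolding power_mult_distrib power2_abs
    using speed[of x y] zero_le_power2[of "cmod (m x - m y)"]
    unfolding power_mult_distrib by linarith
  then show ?thesis by (rule power2_le_imp_le) (simp add: L_nonneg)
qed

text \<open>As \<open>w\<close> avoids 0, it has a continuous logarithm on the contractible line;
  the imaginary part is the angle.\<close>

lemma ex_angle:
  obtains \<theta> where "continuous_on UNIV \<theta>" "\<And>x. w x = of_real (cmod (w x)) * cis (\<theta> x)"
proof -
  have nz: "w x \<noteq> 0" for x using w_ge[of x] \<rho>_pos by auto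
  obtain p where p: "continuous_on UNIV p" "\<And>x. w x = exp (p x)"
    using continuous_logarithm_on_contractible[OF continuous_w[of UNIV] convex_imp_contractible nz]
    by auto
  show ?thesis
  proof (rule that)
    show "continuous_on UNIV (\<lambda>x. Im (p x))" using p(1) by (intro continuous_intros)
    show "w x = of_real (cmod (w x)) * cis (Im (p x))" for x
      unfolding p(2) by (subst exp_eq_polar) (simp add: norm_exp_eq_Re)
  qed
qed

end

locale halving_curve_angle = halving_curve +
  fixes \<theta> :: "real \<Rightarrow> real"
  assumes continuous_angle: "continuous_on UNIV \<theta>"
    and polar: "w x = of_real (cmod (w x)) * cis (\<theta> x)"
begin

lemma cont_angle: "continuous_on S \<theta>"
  using continuous_angle continuous_on_subset by blast

text \<open>Antiperiodicity of \<open>w\<close> gives the increment cosine -1, which excludes values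
  strictly between \<open>- pi\<close> and \<open>pi\<close>.\<close>

lemma angle_half: "pi \<le> \<bar>\<theta> (x + 1/2) - \<theta> x\<bar>"
proof -
  have nz: "cmod (w x) \<noteq> 0" using w_ge[of x] \<rho>_pos by auto
  have "of_real (cmod (w x)) * cis (\<theta> (x + 1/2)) = - (of_real (cmod (w x)) * cis (\<theta> x))"
    using polar[of "x + 1/2"] polar[of x] by (simp add: w_half)
  then have "cis (\<theta> (x + 1/2)) = - cis (\<theta> x)"
    using nz unfolding mult_minus_right[symmetric] mult_cancel_left of_real_eq_0_iff by blast
  then have "cis (\<theta> (x + 1/2) - \<theta> x) = -1" unfolding cis_divide[symmetric] by simp
  then have c: "cos (\<theta> (x + 1/2) - \<theta> x) = -1" by (simp add: complex_eq_iff)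
  show ?thesis
  proof (rule ccontr)
    assume "\<not> ?thesis"
    then have "cos pi < cos \<bar>\<theta> (x + 1/2) - \<theta> x\<bar>" by (intro cos_monotone_0_pi) auto
    then show False using c by simp
  qed
qed

text \<open>The map \<open>(m, \<rho> \<theta>)\<close> is Lipschitz: locally this is a comparison of arcs and chords, and
  Lipschitz bounds at small scale add up along the line.\<close>

lemma m_angle_lipschitz:
  assumes "a \<le> b"
  shows "norm (m b - m a, \<rho> * (\<theta> b - \<theta> a)) \<le> L * (b - a)"
proof -
  \<comment> \<open>A chord is slightly shorter than its arc, so the local estimate needs a factor
    \<open>k\<close> below 1. It is the same along the whole line and tends to 1 at the end.\<close>
  have *: "norm (m b - m a, k * (\<rho> * (\<theta> b - \<theta> a))) \<le> L * (b - a)" if k: "0 < k" "k < 1" for k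
    using assms
  proof (induction a b rule: Bolzano)
    case (trans a b c)
    have "(m c - m a, k * (\<rho> * (\<theta> c - \<theta> a)))
        = (m c - m b, k * (\<rho> * (\<theta> c - \<theta> b))) + (m b - m a, k * (\<rho> * (\<theta> b - \<theta> a)))"
      by (simp add: algebra_simps)
    with trans norm_triangle_ineq[of "(m c - m b, k * (\<rho> * (\<theta> c - \<theta> b)))" "(m b - m a, k * (\<rho> * (\<theta> b - \<theta> a)))"]
    show ?case by (simp add: algebra_simps)
  next
    case (local x)
    obtain e where e: "e > 0" "\<And>y. \<bar>y\<bar> < e \<Longrightarrow> k * \<bar>y\<bar> \<le> \<bar>sin y\<bar>"
      using eventually_sin_ge[OF k(2)] unfolding eventually_nhds_metric by auto
    have "isCont \<theta> x" using continuous_angle by (simp add: continuous_on_eq_continuous_at)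
    then obtain d where d: "d > 0" "\<And>y. \<bar>y - x\<bar> < d \<Longrightarrow> \<bar>\<theta> y - \<theta> x\<bar> < e"
      using e(1) unfolding continuous_at_eps_delta dist_real_def by blast
    have "norm (m v - m u, k * (\<rho> * (\<theta> v - \<theta> u))) \<le> L * (v - u)" if uv: "u \<le> x" "x \<le> v" "v - u < d" for u v
    proof -
      have "\<bar>\<theta> v - \<theta> x\<bar> < e" "\<bar>\<theta> u - \<theta> x\<bar> < e" using uv by (auto intro!: d(2))
      \<comment> \<open>Half of the increment is at most the mean of the two deviations from
        \<open>\<theta> x\<close>, hence below \<open>e\<close>.\<close>
      then have "k * \<bar>(\<theta> v - \<theta> u) / 2\<bar> \<le> \<bar>sin ((\<theta> v - \<theta> u) / 2)\<bar>" by (intro e(2)) auto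
      then have "(k * \<bar>(\<theta> v - \<theta> u) / 2\<bar>)\<^sup>2 \<le> (sin ((\<theta> v - \<theta> u) / 2))\<^sup>2"
        using k(1) by (metis abs_ge_zero mult_nonneg_nonneg less_imp_le power2_abs power_mono)
      then have s: "(k * (\<theta> v - \<theta> u))\<^sup>2 \<le> 4 * (sin ((\<theta> v - \<theta> u) / 2))\<^sup>2"
        by (simp add: power_mult_distrib power_divide)
      have "\<rho>\<^sup>2 \<le> cmod (w v) * cmod (w u)"
        using mult_mono[OF w_ge w_ge, of v u] \<rho>_pos by (simp add: power2_eq_square)
      then have "\<rho>\<^sup>2 * (k * (\<theta> v - \<theta> u))\<^sup>2 \<le> (cmod (w v) * cmod (w u)) * (4 * (sin ((\<theta> v - \<theta> u) / 2))\<^sup>2)"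
        using s by (intro mult_mono) auto
      \<comment> \<open>The radial term \<open>(cmod (w v) - cmod (w u))^2\<close> is
        dropped.\<close>
      also have "\<dots> \<le> (cmod (w v - w u))\<^sup>2"
        using cmod_diff_polar[of "cmod (w v)" "\<theta> v" "cmod (w u)" "\<theta> u"]
        by (simp flip: polar)
      finally have "(cmod (m v - m u))\<^sup>2 + (k * (\<rho> * (\<theta> v - \<theta> u)))\<^sup>2 \<le> (L * (v - u))\<^sup>2"
        using speed[of v u] unfolding power_mult_distrib mult.left_commute[of k] by linarith
      then show ?thesis
        using L_nonneg uv unfolding norm_Pair by (intro real_le_lsqrt) auto
    qed
    with d(1) show ?case by blast
  qed
  have "((\<lambda>k. norm (m b - m a, k * (\<rho> * (\<theta> b - \<theta> a)))) \<longlongrightarrow> norm (m b - m a, 1 * (\<rho> * (\<theta> b - \<theta> a)))) (at_left 1)"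
    by (intro tendsto_intros)
  moreover have "\<forall>\<^sub>F k in at_left 1. norm (m b - m a, k * (\<rho> * (\<theta> b - \<theta> a))) \<le> L * (b - a)"
    using eventually_at_left_real[of 0 1] by (auto elim!: eventually_mono intro: *)
  ultimately have "norm (m b - m a, 1 * (\<rho> * (\<theta> b - \<theta> a))) \<le> L * (b - a)"
    by (rule tendsto_upperbound) simp
  then show ?thesis by simp
qed

end

text \<open>The left side is the distance from \<open>of_real s * cis b\<close> to the line spanned
  by \<open>cis a\<close>. Rotation by \<open>- a\<close> puts this line on the real axis and turns
  the distance into an imaginary part.\<close>

lemma cmod_diff_ge_sin:
  assumes "0 \<le> s"
  shows "s * \<bar>sin (a - b)\<bar> \<le> cmod (of_real r * cis a - of_real s * cis b)"
proof -
  have "(of_real r * cis a - of_real s * cis b) * cis (- a) = of_real r - of_real s * cis (b - a)"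
    by (simp add: left_diff_distrib mult.assoc cis_mult)
  then have "cmod (of_real r * cis a - of_real s * cis b) = cmod (of_real r - of_real s * cis (b - a))"
    by (metis norm_mult norm_cis mult_1_right)
  also have "\<bar>Im (of_real r - of_real s * cis (b - a))\<bar> \<le> \<dots>"
    by (rule abs_Im_le_cmod)
  also have "\<bar>Im (of_real r - of_real s * cis (b - a))\<bar> = s * \<bar>sin (a - b)\<bar>"
    using assms sin_minus[of "a - b"] by (simp add: abs_mult)
  finally show ?thesis .
qed

lemma periodic_representative:
  fixes f :: "real \<Rightarrow> 'a"
  assumes "\<And>x. f (x + c) = f x" and "0 < c"
  obtains y where "0 \<le> y" "y \<le> c" "f y = f x"
proof
  have *: "f (x + of_int n * c) = f x" for n x
  proof (induction n rule: int_induct[where k = 0])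
    case base
    then show ?case by simp
  next
    case (step1 i)
    then show ?case using assms(1)[of "x + of_int i * c"] by (simp add: algebra_simps)
  next
    case (step2 i)
    then show ?case using assms(1)[of "x + of_int (i - 1) * c"] by (simp add: algebra_simps)
  qed
  define y where "y = x + of_int (- \<lfloor>x / c\<rfloor>) * c"
  show "f y = f x" unfolding y_def by (rule *)
  have "y = c * (x / c - of_int \<lfloor>x / c\<rfloor>)" using assms(2) by (simp add: y_def field_simps)
  moreover have "0 \<le> x / c - of_int \<lfloor>x / c\<rfloor>" "x / c - of_int \<lfloor>x / c\<rfloor> \<le> 1" by linarith+
  ultimately show "0 \<le> y" "y \<le> c" using assms(2) by (simp_all add: mult_left_le)
qed

text \<open>The reverse triangle inequality in the Lorentz plane, for two future-directed vectors
  \<open>(a, b)\<close> and \<open>(a', b')\<close> of equal squared length \<open>q\<close>. It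
  reduces to \<open>q + b * b' \<le> a * a'\<close>, an instance of Cauchy-Schwarz.\<close>

lemma reverse_Minkowski_midpoint:
  fixes a a' b b' :: real
  assumes q: "a\<^sup>2 - b\<^sup>2 = q" "a'\<^sup>2 - b'\<^sup>2 = q" and "0 \<le> q" "0 \<le> a" "0 \<le> a'"
  shows "4 * q \<le> (a + a')\<^sup>2 - (b + b')\<^sup>2"
proof -
  have "(q + b * b')\<^sup>2 \<le> (q + b * b')\<^sup>2 + q * (b - b')\<^sup>2" using \<open>0 \<le> q\<close> by simp
  also have "\<dots> = (q + b\<^sup>2) * (q + b'\<^sup>2)" by algebra
  also have "q + b\<^sup>2 = a\<^sup>2" using q by simp
  also have "q + b'\<^sup>2 = a'\<^sup>2" using q by simp
  also have "a\<^sup>2 * a'\<^sup>2 = (a * a')\<^sup>2" by (simp add: power_mult_distrib)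
  finally have "(q + b * b')\<^sup>2 \<le> (a * a')\<^sup>2" .
  then have "q + b * b' \<le> a * a'"
    by (rule power2_le_imp_le) (intro mult_nonneg_nonneg assms)
  then have "4 * q \<le> q + q + (2 * (a * a') - 2 * (b * b'))" by simp
  also have "q + q + (2 * (a * a') - 2 * (b * b')) = (a\<^sup>2 - b\<^sup>2) + (a'\<^sup>2 - b'\<^sup>2) + (2 * (a * a') - 2 * (b * b'))"
    by (simp only: q)
  also have "\<dots> = (a + a')\<^sup>2 - (b + b')\<^sup>2"
    by (simp add: power2_sum)
  finally show ?thesis .
qed

section \<open>Bounds for the midpoint curve and the half-difference curve\<close>

context halving_curve_angle
begin

text \<open>The increments of \<open>m\<close> are replaced by their norms before the two pairs are
  added, so the triangle inequality bounds the sum of distances: \<open>m x\<close> lies in an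
  ellipse with foci \<open>m u\<close> and \<open>m v\<close>.\<close>

lemma m_two_chords:
  assumes "u \<le> x" "x \<le> v"
  shows "(cmod (m x - m u) + cmod (m x - m v))\<^sup>2 \<le> (L * (v - u))\<^sup>2 - (\<rho> * (\<theta> v - \<theta> u))\<^sup>2"
proof -
  have "norm (cmod (m x - m u) + cmod (m v - m x), \<rho> * (\<theta> v - \<theta> u))
      = norm ((cmod (m x - m u), \<rho> * (\<theta> x - \<theta> u)) + (cmod (m v - m x), \<rho> * (\<theta> v - \<theta> x)))"
    by (simp add: algebra_simps)
  also have "\<dots> \<le> norm (cmod (m x - m u), \<rho> * (\<theta> x - \<theta> u)) + norm (cmod (m v - m x), \<rho> * (\<theta> v - \<theta> x))"
    by (rule norm_triangle_ineq)
  also have "\<dots> = norm (m x - m u, \<rho> * (\<theta> x - \<theta> u)) + norm (m v - m x, \<rho> * (\<theta> v - \<theta> x))"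
    by (simp add: norm_Pair)
  also have "\<dots> \<le> L * (x - u) + L * (v - x)"
    using assms by (intro add_mono m_angle_lipschitz)
  also have "\<dots> = L * (v - u)" by (simp add: algebra_simps)
  finally have "(norm (cmod (m x - m u) + cmod (m v - m x), \<rho> * (\<theta> v - \<theta> u)))\<^sup>2 \<le> (L * (v - u))\<^sup>2"
    by (rule power_mono) simp
  then show ?thesis by (simp add: norm_Pair norm_minus_commute)
qed

text \<open>The point \<open>x\<^sub>1\<close> splits the half period evenly with respect to the Lorentz length of the
  time-like curve \<open>(L x, \<rho> \<theta> x)\<close>, which bounds the length of \<open>m\<close>.\<close>

lemma ex_center:
  obtains z where "\<And>x. cmod (m x - z) \<le> sqrt ((L / 2)\<^sup>2 - (pi * \<rho>)\<^sup>2) / 4"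
proof -
  define Q where "Q u v = (L * (v - u))\<^sup>2 - (\<rho> * (\<theta> v - \<theta> u))\<^sup>2" for u v
  have Q_nonneg: "0 \<le> Q u v" if "u \<le> v" for u v
    using order_trans[OF zero_le_power2 m_two_chords[of u u v]] that by (simp add: Q_def)
  have "\<exists>x\<ge>0. x \<le> 1/2 \<and> Q 0 x - Q x (1/2) = 0"
  proof (rule IVT')
    show "continuous_on {0..1/2} (\<lambda>x. Q 0 x - Q x (1/2))"
      unfolding Q_def by (intro continuous_intros cont_angle)
  qed (use Q_nonneg[of 0 "1/2"] in \<open>auto simp: Q_def\<close>)
  then obtain x\<^sub>1 where x\<^sub>1: "0 \<le> x\<^sub>1" "x\<^sub>1 \<le> 1/2" "Q x\<^sub>1 (1/2) = Q 0 x\<^sub>1" by auto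
  have "4 * Q 0 x\<^sub>1 \<le> (L * (x\<^sub>1 - 0) + L * (1/2 - x\<^sub>1))\<^sup>2 - (\<rho> * (\<theta> x\<^sub>1 - \<theta> 0) + \<rho> * (\<theta> (1/2) - \<theta> x\<^sub>1))\<^sup>2"
    by (rule reverse_Minkowski_midpoint) (use x\<^sub>1 L_nonneg Q_nonneg[of 0 x\<^sub>1] in \<open>auto simp: Q_def\<close>)
  also have "\<dots> = (L / 2)\<^sup>2 - (\<rho> * \<bar>\<theta> (0 + 1/2) - \<theta> 0\<bar>)\<^sup>2"
  proof -
    have "L * (x\<^sub>1 - 0) + L * (1/2 - x\<^sub>1) = L / 2"
      and "\<rho> * (\<theta> x\<^sub>1 - \<theta> 0) + \<rho> * (\<theta> (1/2) - \<theta> x\<^sub>1) = \<rho> * (\<theta> (0 + 1/2) - \<theta> 0)"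
      by (simp_all add: algebra_simps)
    then show ?thesis by (simp only: power_mult_distrib power2_abs)
  qed
  also have "\<dots> \<le> (L / 2)\<^sup>2 - (pi * \<rho>)\<^sup>2"
    using mult_left_mono[OF angle_half[of 0], of \<rho>] \<rho>_pos
    by (auto intro!: diff_left_mono power_mono simp: mult.commute)
  finally have Q: "4 * Q 0 x\<^sub>1 \<le> (L / 2)\<^sup>2 - (pi * \<rho>)\<^sup>2" .
  \<comment> \<open>Since \<open>m\<close> has period \<open>1/2\<close>, its arcs over
    \<open>{0..x\<^sub>1}\<close> and \<open>{x\<^sub>1..1/2}\<close> have the same end points, and
    by the choice of \<open>x\<^sub>1\<close> they lie in the same ellipse. Its centre
    \<open>z\<close> is within half the sum of the focal distances.\<close>
  define z where "z = (m 0 + m x\<^sub>1) / 2"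
  have near: "cmod (m x - z) \<le> sqrt ((L / 2)\<^sup>2 - (pi * \<rho>)\<^sup>2) / 4"
    if "(cmod (m x - m 0) + cmod (m x - m x\<^sub>1))\<^sup>2 \<le> Q 0 x\<^sub>1" for x
  proof -
    have "m x - z = ((m x - m 0) + (m x - m x\<^sub>1)) / 2" by (simp add: z_def field_simps)
    then have eq: "cmod (m x - z) = cmod ((m x - m 0) + (m x - m x\<^sub>1)) / 2"
      by (simp only: norm_divide norm_numeral)
    have "cmod (m x - z) \<le> (cmod (m x - m 0) + cmod (m x - m x\<^sub>1)) / 2"
      unfolding eq by (intro divide_right_mono norm_triangle_ineq) simp
    moreover have "2 * (cmod (m x - m 0) + cmod (m x - m x\<^sub>1)) \<le> sqrt ((L / 2)\<^sup>2 - (pi * \<rho>)\<^sup>2)"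
    proof (rule real_le_rsqrt)
      have "(2 * (cmod (m x - m 0) + cmod (m x - m x\<^sub>1)))\<^sup>2 = 4 * (cmod (m x - m 0) + cmod (m x - m x\<^sub>1))\<^sup>2"
        unfolding power_mult_distrib by simp
      then show "(2 * (cmod (m x - m 0) + cmod (m x - m x\<^sub>1)))\<^sup>2 \<le> (L / 2)\<^sup>2 - (pi * \<rho>)\<^sup>2"
        using that Q by linarith
    qed
    ultimately show ?thesis by linarith
  qed
  have "cmod (m x - z) \<le> sqrt ((L / 2)\<^sup>2 - (pi * \<rho>)\<^sup>2) / 4" for x
  proof -
    obtain y where y: "0 \<le> y" "y \<le> 1/2" "m y = m x"
      using periodic_representative[of m "1/2" x, OF m_half half_gt_zero[OF zero_less_one]] .
    have "(cmod (m y - m 0) + cmod (m y - m x\<^sub>1))\<^sup>2 \<le> Q 0 x\<^sub>1"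
    proof (cases "y \<le> x\<^sub>1")
      case True
      then show ?thesis using m_two_chords[of 0 y x\<^sub>1] y(1) by (simp add: Q_def)
    next
      case False
      then have "(cmod (m y - m x\<^sub>1) + cmod (m y - m (0 + 1/2)))\<^sup>2 \<le> Q x\<^sub>1 (1/2)"
        using m_two_chords[of x\<^sub>1 y "1/2"] y(2) by (simp add: Q_def)
      then show ?thesis unfolding m_half x\<^sub>1(3) by (simp only: add.commute)
    qed
    from near[OF this] show ?thesis unfolding y(3) .
  qed
  then show thesis by (rule that)
qed

text \<open>A curve from \<open>w x\<close> to its antipode outside the disc of radius \<open>\<rho>\<close> reaches and leaves the two
  rays at angle \<open>\<alpha>\<close> from its end points, each at distance at least \<open>\<bar>w x\<bar> sin \<alpha>\<close> from the end point.\<close>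

lemma w_sin_le:
  assumes \<alpha>: "0 < \<alpha>" "\<alpha> < pi / 2"
  shows "2 * (cmod (w x) * sin \<alpha>) + \<rho> * (pi - 2 * \<alpha>) \<le> L / 2"
proof -
  define T where "T = \<theta> (x + 1/2) - \<theta> x"
  \<comment> \<open>The sign makes the turning angle \<psi> run from 0 to
    \<open>\<bar>T\<bar>\<close> for either sense of rotation.\<close>
  define \<sigma> where "\<sigma> = sgn T"
  have T: "pi \<le> \<bar>T\<bar>" unfolding T_def by (rule angle_half)
  then have \<sigma>: "\<bar>\<sigma>\<bar> = 1" "\<sigma> * T = \<bar>T\<bar>" using pi_gt3 by (auto simp: \<sigma>_def sgn_if)
  define \<psi> where "\<psi> y = \<sigma> * (\<theta> y - \<theta> x)" for y
  have cont: "continuous_on S \<psi>" for S unfolding \<psi>_def by (intro continuous_intros cont_angle)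
  have ends: "\<psi> x = 0" "\<psi> (x + 1/2) = \<bar>T\<bar>" using \<sigma>(2) by (simp_all add: \<psi>_def T_def)
  have diff: "\<bar>\<theta> u - \<theta> v\<bar> = \<bar>\<psi> u - \<psi> v\<bar>" for u v
    using \<sigma>(1) by (simp add: \<psi>_def abs_mult flip: right_diff_distrib)
  obtain a where a: "x \<le> a" "a \<le> x + 1/2" "\<psi> a = \<alpha>"
    using IVT'[of \<psi> x \<alpha> "x + 1/2"] cont ends \<alpha> T by auto
  obtain b where b: "a \<le> b" "b \<le> x + 1/2" "\<psi> b = \<bar>T\<bar> - \<alpha>"
    using IVT'[of \<psi> a "\<bar>T\<bar> - \<alpha>" "x + 1/2"] cont ends \<alpha> T a by auto
  have chord: "cmod (w x) * sin \<alpha> \<le> L * \<bar>u - v\<bar>"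
    if "\<bar>\<psi> u - \<psi> v\<bar> = \<alpha>" "cmod (w v) = cmod (w x)" for u v
  proof -
    have "\<bar>\<theta> u - \<theta> v\<bar> = \<alpha>" using that diff by simp
    then have "\<bar>sin (\<theta> u - \<theta> v)\<bar> = \<bar>sin \<alpha>\<bar>" using sin_minus[of "\<theta> u - \<theta> v"] by (auto simp: abs_real_def split: if_splits)
    then have "cmod (w x) * sin \<alpha> \<le> cmod (w v) * \<bar>sin (\<theta> u - \<theta> v)\<bar>"
      using that(2) by (simp add: mult_left_mono)
    also have "\<dots> \<le> cmod (w u - w v)"
      using cmod_diff_ge_sin[of "cmod (w v)" "\<theta> u" "\<theta> v" "cmod (w u)"] by (simp flip: polar)
    also have "\<dots> \<le> L * \<bar>u - v\<bar>" by (rule w_lipschitz)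
    finally show ?thesis .
  qed
  have "cmod (w x) * sin \<alpha> \<le> L * \<bar>a - x\<bar>" by (rule chord) (use a ends \<alpha> in auto)
  moreover have "cmod (w x) * sin \<alpha> \<le> L * \<bar>b - (x + 1/2)\<bar>"
    by (rule chord) (use b ends \<alpha> in \<open>auto simp: w_half\<close>)
  \<comment> \<open>Between the two rays \<open>w\<close> still turns by
    \<open>\<bar>T\<bar> - 2 * \<alpha>\<close>, at a cost in length of at least \<rho> per unit of
    angle.\<close>
  moreover have "\<rho> * (pi - 2 * \<alpha>) \<le> L * (b - a)"
  proof -
    have "\<rho> * (pi - 2 * \<alpha>) \<le> \<rho> * \<bar>\<theta> b - \<theta> a\<bar>"
      unfolding diff a(3) b(3) using \<rho>_pos T by (intro mult_left_mono) auto
    also have "\<dots> = norm (\<rho> * (\<theta> b - \<theta> a))"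
      using \<rho>_pos by (simp add: abs_mult)
    also have "\<dots> \<le> L * (b - a)"
      by (rule order_trans[OF norm_snd_le m_angle_lipschitz[OF b(1)]])
    finally show ?thesis .
  qed
  ultimately show ?thesis using a b by (simp add: algebra_simps)
qed

end

context halving_curve
begin

lemma ex_halving_curve_angle: obtains \<theta> where "halving_curve_angle \<gamma> L \<rho> \<theta>"
proof -
  obtain \<theta> where "continuous_on UNIV \<theta>" "\<And>x. w x = of_real (cmod (w x)) * cis (\<theta> x)"
    using ex_angle by blast
  then have "halving_curve_angle \<gamma> L \<rho> \<theta>" by unfold_locales
  then show thesis by (rule that)
qed

text \<open>Division of \<open>w_sin_le\<close> by \<open>sin \<alpha>\<close> leaves a relative
  excess of about \<open>\<alpha>^2 / 6\<close> from the sine and \<open>pi * \<alpha>^3 / 2\<close>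
  from the length. For \<open>\<alpha> \<le> 0.1\<close> the latter is below
  \<open>0.16 * \<alpha>^2\<close>, and 0.35 leaves room for the higher terms.\<close>

lemma w_le_fourth_power:
  assumes "L \<le> 2 * pi * \<rho> * (1 + \<alpha> ^ 4)" "0 < \<alpha>" "\<alpha> \<le> 0.1"
  shows "cmod (w x) \<le> \<rho> * (1 + 0.35 * \<alpha>\<^sup>2)"
proof -
  obtain \<theta> where "halving_curve_angle \<gamma> L \<rho> \<theta>" by (rule ex_halving_curve_angle)
  then interpret halving_curve_angle \<gamma> L \<rho> \<theta> .
  have sin: "\<alpha> * (1 - \<alpha>\<^sup>2 / 6) \<le> sin \<alpha>"
  proof -
    have "\<bar>sin \<alpha> - (\<Sum>i<3. sin_coeff i * \<alpha> ^ i)\<bar> \<le> inverse (fact 3) * \<bar>\<alpha>\<bar> ^ 3"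
      by (rule Maclaurin_sin_bound)
    then have "\<bar>sin \<alpha> - \<alpha>\<bar> \<le> \<alpha> ^ 3 / 6"
      using assms(2) by (simp add: numeral_3_eq_3 sin_coeff_def fact_numeral)
    then have "\<alpha> - \<alpha> ^ 3 / 6 \<le> sin \<alpha>" by linarith
    then show ?thesis by (simp add: algebra_simps power2_eq_square power3_eq_cube)
  qed
  have "2 * (cmod (w x) * sin \<alpha>) + \<rho> * (pi - 2 * \<alpha>) \<le> L / 2"
    by (rule w_sin_le) (use assms pi_gt3 in auto)
  moreover have "L / 2 \<le> pi * \<rho> * (1 + \<alpha> ^ 4)" using assms(1) by simp
  ultimately have "cmod (w x) * sin \<alpha> \<le> \<rho> * (\<alpha> + pi * \<alpha> ^ 4 / 2)" by (simp add: algebra_simps)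
  also have "\<dots> \<le> \<rho> * ((1 + 0.35 * \<alpha>\<^sup>2) * (\<alpha> * (1 - \<alpha>\<^sup>2 / 6)))"
  proof (rule mult_left_mono)
    have "pi * \<alpha> \<le> 3.2 * 0.1" using assms pi_less_4 pi_approx by (intro mult_mono) auto
    moreover have "\<alpha>\<^sup>2 \<le> 0.1\<^sup>2" using assms by (intro power_mono) auto
    ultimately have "0 \<le> \<alpha> ^ 3 * (0.35 - 1/6 - 0.35 * \<alpha>\<^sup>2 / 6 - pi * \<alpha> / 2)"
      using assms by (intro mult_nonneg_nonneg) (auto simp: power2_eq_square)
    then show "\<alpha> + pi * \<alpha> ^ 4 / 2 \<le> (1 + 0.35 * \<alpha>\<^sup>2) * (\<alpha> * (1 - \<alpha>\<^sup>2 / 6))"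
      by (simp add: algebra_simps power2_eq_square power3_eq_cube power4_eq_xxxx)
  qed (use \<rho>_pos in simp)
  also have "\<dots> \<le> \<rho> * (1 + 0.35 * \<alpha>\<^sup>2) * sin \<alpha>"
    using mult_left_mono[OF sin, of "\<rho> * (1 + 0.35 * \<alpha>\<^sup>2)"] \<rho>_pos by (simp add: mult.assoc)
  finally show ?thesis
    using sin_gt_zero[of \<alpha>] assms pi_gt3 by simp
qed

lemma w_le:
  assumes L: "L \<le> 2 * pi * \<rho> * (1 + \<epsilon>)" and \<epsilon>: "0 \<le> \<epsilon>" "\<epsilon> \<le> 0.0001"
  shows "cmod (w x) \<le> \<rho> * (1 + 0.35 * sqrt \<epsilon>)"
proof -
  \<comment> \<open>The angle in the previous lemma must be positive, so \<epsilon> is first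
    enlarged to a positive \<delta>; the case \<open>\<epsilon> = 0\<close> is the limit of these
    bounds.\<close>
  have *: "cmod (w x) \<le> \<rho> * (1 + 0.35 * sqrt \<delta>)" if "\<epsilon> \<le> \<delta>" "0 < \<delta>" "\<delta> \<le> 0.0001" for \<delta>
  proof -
    \<comment> \<open>The excess is bounded by \<open>O(\<delta> / \<alpha> + \<alpha>\<^sup>2)\<close>; this \<open>\<alpha>\<close> makes it \<open>O(\<surd>\<delta>)\<close>.\<close>
    define \<alpha> where "\<alpha> = sqrt (sqrt \<delta>)"
    have a: "\<alpha>\<^sup>2 = sqrt \<delta>" "0 < \<alpha>" using that by (simp_all add: \<alpha>_def)
    have "\<alpha> ^ 4 = (\<alpha>\<^sup>2)\<^sup>2" by (simp flip: power_mult)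
    then have "\<alpha> ^ 4 = \<delta>" using that by (simp add: a)
    have "\<alpha> ^ 4 \<le> 0.1 ^ 4" unfolding \<open>\<alpha> ^ 4 = \<delta>\<close> using that by (simp add: power4_eq_xxxx)
    then have "\<alpha> \<le> 0.1" using power_le_imp_le_base[of \<alpha> 3 "0.1"] by (simp add: eval_nat_numeral)
    have "L \<le> 2 * pi * \<rho> * (1 + \<alpha> ^ 4)"
      unfolding \<open>\<alpha> ^ 4 = \<delta>\<close> by (rule order_trans[OF L]) (use \<rho>_pos that in \<open>auto intro!: mult_left_mono\<close>)
    from w_le_fourth_power[OF this a(2) \<open>\<alpha> \<le> 0.1\<close>] show ?thesis by (simp add: a)
  qed
  show ?thesis
  proof (cases "\<epsilon> = 0")
    case True
    have "((\<lambda>\<delta>. \<rho> * (1 + 0.35 * sqrt \<delta>)) \<longlongrightarrow> \<rho> * (1 + 0.35 * sqrt 0)) (at_right 0)"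
      by (intro tendsto_intros)
    moreover have "\<forall>\<^sub>F \<delta> in at_right 0. cmod (w x) \<le> \<rho> * (1 + 0.35 * sqrt \<delta>)"
    proof (rule eventually_mono[OF eventually_at_right_real[of 0 "0.0001"]])
      show "cmod (w x) \<le> \<rho> * (1 + 0.35 * sqrt \<delta>)" if "\<delta> \<in> {0<..<0.0001}" for \<delta>
        by (rule *) (use that True in auto)
    qed simp
    ultimately have "cmod (w x) \<le> \<rho> * (1 + 0.35 * sqrt 0)"
      by (rule tendsto_lowerbound) simp
    then show ?thesis by (simp add: True)
  qed (use * \<epsilon> in auto)
qed

end

text \<open>Opposite values at the ends would force a zero of \<open>q\<close> in between, where the
  cosine is 1.\<close>

lemma cos_neg_no_sign_change:
  fixes q :: "real \<Rightarrow> real"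
  assumes "continuous_on {a..b} q" "a \<le> b" "\<And>x. x \<in> {a..b} \<Longrightarrow> cos (q x) < 0"
  shows "q b \<noteq> - q a"
proof
  assume "q b = - q a"
  then have "\<exists>x\<in>{a..b}. q x = 0"
    using IVT'[of q a 0 b] IVT2'[of q b 0 a] assms(1,2) by (cases "q a \<le> 0") auto
  then show False using assms(3) by force
qed

section \<open>The centre lies inside the curve, and the thin ring about it\<close>

context halving_curve
begin

text \<open>If \<open>z\<close> were outside, \<open>\<gamma> - z\<close> would have a periodic logarithm. Its increment over half a period
  changes sign along that half period, but it stays close to an odd multiple of \<open>\<pi>\<close>, since
  \<open>\<gamma> - z\<close> and its half-period translate point to opposite sides.\<close>

lemma center_in_inside:
  assumes near: "\<And>x. cmod (m x - z) < cmod (w x)"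
  shows "z \<in> inside (\<gamma> ` {0..1})"
proof (rule ccontr)
  assume "z \<notin> inside (\<gamma> ` {0..1})"
  have path: "path \<gamma>" by (simp add: path_def continuous_\<gamma>)
  have loop: "pathfinish \<gamma> = pathstart \<gamma>"
    using periodic[of 0] by (simp add: pathfinish_def pathstart_def)
  have "\<gamma> x \<noteq> z" for x
  proof
    assume "\<gamma> x = z"
    then have "m x - z = m x - \<gamma> x" by simp
    also have "\<dots> = - w x" by (simp add: \<gamma>_eq)
    finally show False using near[of x] by simp
  qed
  then have nin: "z \<notin> path_image \<gamma>" by (auto simp: path_image_def)
  then have "z \<in> outside (path_image \<gamma>)"
    using \<open>z \<notin> inside _\<close> by (simp add: outside_inside path_image_def)
  then have "winding_number \<gamma> z = 0" by (rule winding_number_zero_in_outside[OF path loop])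
  then obtain p where p: "path p" "pathfinish p = pathstart p" "\<And>t. t \<in> {0..1} \<Longrightarrow> \<gamma> t = z + exp (p t)"
    using winding_number_as_continuous_log[OF path nin] by (metis diff_eq_diff_eq diff_self mult_zero_right)
  define q where "q x = Im (p (x + 1/2)) - Im (p x)" for x
  have "q (1/2) \<noteq> - q 0"
  proof (rule cos_neg_no_sign_change[of 0 "1/2" q])
    have cont: "continuous_on {0..1} p" using p(1) by (simp add: path_def)
    have "continuous_on {0..1/2} p" by (rule continuous_on_subset[OF cont]) simp
    moreover have "continuous_on {0..1/2} (\<lambda>x. p (x + 1/2))"
      by (rule continuous_on_compose2[OF cont]) (auto intro!: continuous_intros)
    ultimately show "continuous_on {0..1/2} q" unfolding q_def by (intro continuous_intros)
  next
    fix x :: real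
    assume x: "x \<in> {0..1/2}"
    define a b where "a = \<gamma> x - z" and "b = \<gamma> (x + 1/2) - z"
    have ab: "a = exp (p x)" "b = exp (p (x + 1/2))"
      using x p(3)[of x] p(3)[of "x + 1/2"] unfolding a_def b_def by auto
    have "\<gamma> (x + 1/2) = m x - w x"
      using \<gamma>_eq[of "x + 1/2"] unfolding m_half w_half by (simp only: diff_conv_add_uminus)
    then have "a = (m x - z) + w x" "b = (m x - z) - w x"
      unfolding a_def b_def by (simp add: \<gamma>_eq, simp)
    \<comment> \<open>The scalar product of the vectors \<open>(m x - z) + w x\<close> and
      \<open>(m x - z) - w x\<close> is a difference of squares. It is negative by
      \<open>near\<close>, so they are more than a right angle apart.\<close>
    then have "Re (b * cnj a) = Re (((m x - z) - w x) * cnj ((m x - z) + w x))" by simp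
    also have "\<dots> = (cmod (m x - z))\<^sup>2 - (cmod (w x))\<^sup>2"
      unfolding cmod_power2 by (simp add: algebra_simps power2_eq_square)
    also have "\<dots> < 0" using near[of x] by (simp add: power_strict_mono)
    finally have "Re (b * cnj a) < 0" .
    also have "b * cnj a = exp (p (x + 1/2) + cnj (p x))"
      unfolding ab by (simp add: exp_add exp_cnj)
    also have "Re \<dots> = exp (Re (p (x + 1/2) + cnj (p x))) * cos (q x)"
      by (simp add: Re_exp q_def)
    finally show "cos (q x) < 0" by (simp add: mult_less_0_iff)
  qed simp
  moreover have "q (1/2) = - q 0"
    using p(2) by (simp add: q_def pathfinish_def pathstart_def)
  ultimately show False by simp
qed

theorem ex_ring:
  assumes L: "L \<le> 2 * pi * \<rho> * (1 + \<epsilon>)" and \<epsilon>: "0 \<le> \<epsilon>" "\<epsilon> \<le> 0.0001"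
  obtains z r where "0 < r" "z \<in> inside (\<gamma> ` {0..1})"
    "\<And>x. r \<le> cmod (\<gamma> x - z)" "\<And>x. cmod (\<gamma> x - z) \<le> (1 + 3 * sqrt \<epsilon>) * r"
proof -
  obtain \<theta> where "halving_curve_angle \<gamma> L \<rho> \<theta>" by (rule ex_halving_curve_angle)
  then interpret halving_curve_angle \<gamma> L \<rho> \<theta> .
  define e where "e = sqrt \<epsilon>"
  have e: "0 \<le> e" "e\<^sup>2 = \<epsilon>" using \<epsilon> by (simp_all add: e_def)
  have "e\<^sup>2 \<le> 0.01\<^sup>2" using e(2) \<epsilon> by (simp add: power2_eq_square)
  then have "e \<le> 0.01" by (rule power2_le_imp_le) simp
  obtain z where z: "\<And>x. cmod (m x - z) \<le> sqrt ((L / 2)\<^sup>2 - (pi * \<rho>)\<^sup>2) / 4"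
    by (rule ex_center) blast
  \<comment> \<open>The root is at most
    \<open>pi * \<rho> * sqrt (2 * \<epsilon> + \<epsilon>^2)\<close>; 1.12 is a round value above
    \<open>pi * sqrt 2.0001 / 4\<close>.\<close>
  have "sqrt ((L / 2)\<^sup>2 - (pi * \<rho>)\<^sup>2) \<le> 4 * (1.12 * \<rho> * e)"
  proof (rule real_le_lsqrt)
    have "pi\<^sup>2 \<le> 3.1416\<^sup>2" using pi_approx pi_gt3 by (intro power_mono) auto
    moreover have "0 \<le> 2 * \<epsilon> + \<epsilon>\<^sup>2" "2 * \<epsilon> + \<epsilon>\<^sup>2 \<le> 2.0001 * \<epsilon>"
      using \<epsilon> mult_right_mono[OF \<epsilon>(2) \<epsilon>(1)] by (simp_all add: power2_eq_square)
    ultimately have "pi\<^sup>2 * (2 * \<epsilon> + \<epsilon>\<^sup>2) \<le> 3.1416\<^sup>2 * (2.0001 * \<epsilon>)"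
      by (intro mult_mono) auto
    also have "\<dots> \<le> (4 * 1.12)\<^sup>2 * \<epsilon>" using \<epsilon> by (simp add: power2_eq_square)
    finally have *: "pi\<^sup>2 * (2 * \<epsilon> + \<epsilon>\<^sup>2) \<le> (4 * 1.12)\<^sup>2 * \<epsilon>" .
    have "(L / 2)\<^sup>2 \<le> (pi * \<rho> * (1 + \<epsilon>))\<^sup>2" using L L_nonneg by (intro power_mono) auto
    then have "(L / 2)\<^sup>2 - (pi * \<rho>)\<^sup>2 \<le> \<rho>\<^sup>2 * (pi\<^sup>2 * (2 * \<epsilon> + \<epsilon>\<^sup>2))"
      by (simp add: power2_eq_square algebra_simps)
    also have "\<dots> \<le> \<rho>\<^sup>2 * ((4 * 1.12)\<^sup>2 * \<epsilon>)" using * by (rule mult_left_mono) simp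
    also have "\<dots> = (4 * (1.12 * \<rho> * e))\<^sup>2" by (simp add: power_mult_distrib power_divide flip: e(2))
    finally show "(L / 2)\<^sup>2 - (pi * \<rho>)\<^sup>2 \<le> (4 * (1.12 * \<rho> * e))\<^sup>2" .
  qed (use e \<rho>_pos in auto)
  then have m: "cmod (m x - z) \<le> 1.12 * \<rho> * e" for x using z[of x] by linarith
  have split: "\<gamma> x - z = (m x - z) + w x" for x by (simp add: \<gamma>_eq)
  define r where "r = \<rho> * (1 - 1.12 * e)"
  have "0 < r" using \<rho>_pos \<open>e \<le> 0.01\<close> by (simp add: r_def)
  then have small: "1.12 * \<rho> * e < \<rho>" by (simp add: r_def algebra_simps)
  show thesis
  proof (rule that)
    show "0 < r" by fact
    show "z \<in> inside (\<gamma> ` {0..1})"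
    proof (rule center_in_inside)
      show "cmod (m x - z) < cmod (w x)" for x using m[of x] w_ge[of x] small by linarith
    qed
    show "r \<le> cmod (\<gamma> x - z)" for x
    proof -
      have "\<rho> - 1.12 * \<rho> * e \<le> cmod (\<gamma> x - z)"
        unfolding split using norm_diff_ineq[of "w x" "m x - z"] m[of x] w_ge[of x]
        unfolding add.commute[of "w x"] by linarith
      then show ?thesis by (simp add: r_def algebra_simps)
    qed
    show "cmod (\<gamma> x - z) \<le> (1 + 3 * sqrt \<epsilon>) * r" for x
    proof -
      have "cmod (\<gamma> x - z) \<le> cmod (m x - z) + cmod (w x)" unfolding split by (rule norm_triangle_ineq)
      also have "\<dots> \<le> 1.12 * \<rho> * e + \<rho> * (1 + 0.35 * e)"
        using m[of x] w_le[OF L \<epsilon>, of x] by (simp add: e_def)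
      also have "\<dots> = \<rho> * (1 + 1.47 * e)" by (simp add: algebra_simps)
      \<comment> \<open>The coefficient 1.47 is 1.12 from \<open>m\<close> plus 0.35 from
        \<open>w\<close>. The linear surplus \<open>3 - 1.12 - 1.47 = 0.41\<close> absorbs the
        quadratic term \<open>3.36 * e^2\<close>.\<close>
      also have "\<dots> \<le> \<rho> * ((1 + 3 * e) * (1 - 1.12 * e))"
      proof (rule mult_left_mono)
        have "0 \<le> e * (0.41 - 3.36 * e)" using e(1) \<open>e \<le> 0.01\<close> by (intro mult_nonneg_nonneg) auto
        moreover have "(1 + 3 * e) * (1 - 1.12 * e) = 1 + 1.47 * e + e * (0.41 - 3.36 * e)"
          by (simp add: field_simps)
        ultimately show "1 + 1.47 * e \<le> (1 + 3 * e) * (1 - 1.12 * e)" by simp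
      qed (use \<rho>_pos in simp)
      also have "\<dots> = (1 + 3 * sqrt \<epsilon>) * r" by (simp add: r_def e_def)
      finally show ?thesis .
    qed
  qed
qed

end

section \<open>Arc length and curve distance\<close>

definition speed_at :: "(real \<Rightarrow> real^2) \<Rightarrow> real \<Rightarrow> real" where
  "speed_at g t = norm (vector_derivative g (at t))"

lemma arc_length_eq: "arc_length g a b = integral {a..b} (speed_at g)"
  by (simp add: arc_length_def speed_at_def[abs_def])

text \<open>The speed agrees with the continuous function \<open>norm (D t)\<close> except possibly
  at the two end points, where a two-sided derivative may fail to exist; two points do not affect
  integrability.\<close>

lemma consecutive_C1_piece:
  assumes D: "continuous_on {a..b} D" "\<And>t. t \<in> {a..b} \<Longrightarrow> (g has_vector_derivative D t) (at t within {a..b})"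
  shows "speed_at g integrable_on {a..b}"
    and "\<And>t. a < t \<Longrightarrow> t < b \<Longrightarrow> (g has_vector_derivative vector_derivative g (at t)) (at t)"
proof -
  have at: "(g has_vector_derivative D t) (at t)" if "a < t" "t < b" for t
    using D(2)[of t] that by (simp add: at_within_Icc_at)
  then show "(g has_vector_derivative vector_derivative g (at t)) (at t)" if "a < t" "t < b" for t
    using that by (metis vector_derivative_at)
  have "(\<lambda>t. norm (D t)) integrable_on cbox a b"
    using D(1) by (auto intro!: integrable_continuous_interval continuous_intros)
  then have "speed_at g integrable_on cbox a b"
    by (rule integrable_spike_interior[rotated]) (use vector_derivative_at[OF at] in \<open>auto simp: speed_at_def\<close>)
  then show "speed_at g integrable_on {a..b}" by simp
qed

text \<open>A point off \<open>S\<close> lies strictly between consecutive breakpoints.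
  Integrability passes from one breakpoint to the next: the least one where it fails would have a
  predecessor where it holds.\<close>

lemma piecewise_C1_pathE:
  assumes "piecewise_C1_path g"
  obtains S where "finite S" "\<And>t. t \<in> {0..1} - S \<Longrightarrow> (g has_vector_derivative vector_derivative g (at t)) (at t)"
    "speed_at g integrable_on {0..1}" "continuous_on {0..1} g"
proof -
  obtain S where S: "finite S" "{0, 1} \<subseteq> S" "S \<subseteq> {0..1}"
    and ex_D: "\<forall>a\<in>S. \<forall>b\<in>S. a < b \<and> {a<..<b} \<inter> S = {} \<longrightarrow>
      (\<exists>D. continuous_on {a..b} D \<and> (\<forall>t\<in>{a..b}. (g has_vector_derivative D t) (at t within {a..b})))"
    using assms unfolding piecewise_C1_path_def by (elim conjE exE)
  have piece: thesis
    if "a \<in> S" "b \<in> S" "a < b" "{a<..<b} \<inter> S = {}"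
      "\<And>D. continuous_on {a..b} D \<Longrightarrow>
        (\<And>t. t \<in> {a..b} \<Longrightarrow> (g has_vector_derivative D t) (at t within {a..b})) \<Longrightarrow> thesis"
    for a b thesis
    using ex_D that by metis
  have pred: "\<exists>a\<in>S. a < t \<and> {a<..<t} \<inter> S = {}" if "0 < t" for t
  proof -
    have *: "finite {x \<in> S. x < t}" "0 \<in> {x \<in> S. x < t}" using S that by auto
    then have "Max {x \<in> S. x < t} \<in> {x \<in> S. x < t}" by (intro Max_in) auto
    moreover have "x \<le> Max {x \<in> S. x < t}" if "x \<in> S" "x < t" for x
      using *(1) that by (intro Max_ge) auto
    ultimately show ?thesis by force
  qed
  have succ: "\<exists>b\<in>S. t < b \<and> {t<..<b} \<inter> S = {}" if "t < 1" for t
  proof -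
    have *: "finite {x \<in> S. t < x}" "1 \<in> {x \<in> S. t < x}" using S that by auto
    then have "Min {x \<in> S. t < x} \<in> {x \<in> S. t < x}" by (intro Min_in) auto
    moreover have "Min {x \<in> S. t < x} \<le> x" if "x \<in> S" "t < x" for x
      using *(1) that by (intro Min_le) auto
    ultimately show ?thesis by force
  qed
  show thesis
  proof (rule that[of S])
    show "finite S" by fact
    show "continuous_on {0..1} g" using assms by (simp add: piecewise_C1_path_def path_def)
  next
    fix t :: real
    assume t: "t \<in> {0..1} - S"
    then have "0 < t" "t < 1" using S(2) by (auto simp: less_le)
    obtain a where a: "a \<in> S" "a < t" "{a<..<t} \<inter> S = {}" using pred[OF \<open>0 < t\<close>] by auto
    obtain b where b: "b \<in> S" "t < b" "{t<..<b} \<inter> S = {}" using succ[OF \<open>t < 1\<close>] by auto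
    have "{a<..<b} \<inter> S = {}"
    proof -
      have "{a<..<b} \<subseteq> {a<..<t} \<union> {t} \<union> {t<..<b}" by auto
      then show ?thesis using a(3) b(3) t by blast
    qed
    then obtain D where "continuous_on {a..b} D" "\<And>t. t \<in> {a..b} \<Longrightarrow> (g has_vector_derivative D t) (at t within {a..b})"
      using piece[OF a(1) b(1)] a(2) b(2) by (metis order_less_trans)
    from consecutive_C1_piece(2)[OF this] a b
    show "(g has_vector_derivative vector_derivative g (at t)) (at t)" by blast
  next
    define B where "B = {t \<in> S. \<not> speed_at g integrable_on {0..t}}"
    have "B = {}"
    proof (rule ccontr)
      assume "B \<noteq> {}"
      define t where "t = Min B"
      have "finite B" using S(1) by (simp add: B_def)
      then have t: "t \<in> B" and min: "\<And>x. x \<in> B \<Longrightarrow> t \<le> x" using \<open>B \<noteq> {}\<close> by (auto simp: t_def)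
      then have "t \<in> S" "\<not> speed_at g integrable_on {0..t}" by (auto simp: B_def)
      moreover have "speed_at g integrable_on {0..0}" using integrable_on_refl[of "speed_at g" 0] by simp
      ultimately have "t \<noteq> 0" by auto
      then have "0 < t" using \<open>t \<in> S\<close> S(3) by force
      obtain a where a: "a \<in> S" "a < t" "{a<..<t} \<inter> S = {}" using pred[OF \<open>0 < t\<close>] by auto
      have "a \<notin> B" using min[of a] a(2) by auto
      then have 1: "speed_at g integrable_on {0..a}" using a(1) by (simp add: B_def)
      obtain D where "continuous_on {a..t} D" "\<And>s. s \<in> {a..t} \<Longrightarrow> (g has_vector_derivative D s) (at s within {a..t})"
        using piece[OF a(1) \<open>t \<in> S\<close> a(2,3)] by blast
      then have 2: "speed_at g integrable_on {a..t}" by (rule consecutive_C1_piece(1))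
      have "0 \<le> a" using a(1) S(3) by auto
      with 1 2 a(2) have "speed_at g integrable_on {0..t}"
        by (intro Henstock_Kurzweil_Integration.integrable_combine[of 0 a t]) auto
      then show False using t by (simp add: B_def)
    qed
    then show "speed_at g integrable_on {0..1}" using S(2) by (auto simp: B_def)
  qed
qed

lemma speed_integrable:
  assumes "piecewise_C1_path g" "0 \<le> a" "b \<le> 1"
  shows "speed_at g integrable_on {a..b}"
proof -
  obtain S where "speed_at g integrable_on {0..1}" using piecewise_C1_pathE[OF assms(1)] by blast
  then show ?thesis by (rule integrable_on_subinterval) (use assms in auto)
qed

text \<open>The fundamental theorem of calculus with finitely many exceptional points, followed by
  the norm bound for integrals.\<close>

lemma dist_le_arc_length:
  assumes g: "piecewise_C1_path g" and ab: "0 \<le> a" "a \<le> b" "b \<le> 1"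
  shows "dist (g a) (g b) \<le> arc_length g a b"
proof -
  obtain S where S: "finite S" "\<And>t. t \<in> {0..1} - S \<Longrightarrow> (g has_vector_derivative vector_derivative g (at t)) (at t)"
    "continuous_on {0..1} g"
    using piecewise_C1_pathE[OF g] by blast
  have int: "((\<lambda>t. vector_derivative g (at t)) has_integral (g b - g a)) {a..b}"
  proof (rule fundamental_theorem_of_calculus_interior_strong[OF S(1) ab(2)])
    show "continuous_on {a..b} g" by (rule continuous_on_subset[OF S(3)]) (use ab in auto)
  qed (use ab S(2) in auto)
  have "norm (g b - g a) \<le> integral {a..b} (speed_at g)"
    unfolding integral_unique[OF int, symmetric]
    by (rule Henstock_Kurzweil_Integration.integral_norm_bound_integral)
       (use int ab speed_integrable[OF g] in \<open>auto simp: speed_at_def has_integral_integrable\<close>)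
  then show ?thesis by (simp add: arc_length_eq dist_norm norm_minus_commute)
qed

lemma arc_length_combine:
  assumes "piecewise_C1_path g" "0 \<le> a" "a \<le> b" "b \<le> c" "c \<le> 1"
  shows "arc_length g a b + arc_length g b c = arc_length g a c"
  unfolding arc_length_eq
  by (rule Henstock_Kurzweil_Integration.integral_combine) (use assms speed_integrable in auto)

lemma continuous_on_arc_length:
  assumes "piecewise_C1_path g"
  shows "continuous_on {0..1} (arc_length g 0)"
  unfolding arc_length_eq[abs_def]
  by (rule indefinite_integral_continuous_1) (use speed_integrable[OF assms] in auto)

lemma simple_closed_curve_inj:
  assumes "simple_closed_curve g"
  shows "inj_on g {0..<1}"
  using assms by (force simp: simple_closed_curve_def simple_path_def loop_free_def inj_on_def)

text \<open>Derivatives may vanish, so positivity comes from injectivity. The midpoint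
  \<open>c\<close> of the interval serves as second point because \<open>g a = g b\<close> when
  \<open>a = 0\<close> and \<open>b = 1\<close>.\<close>

lemma arc_length_pos:
  assumes g: "simple_closed_curve g" and ab: "0 \<le> a" "a < b" "b \<le> 1"
  shows "0 < arc_length g a b"
proof -
  have C1: "piecewise_C1_path g" using g by (simp add: simple_closed_curve_def)
  define c where "c = (a + b) / 2"
  have c: "a < c" "c < b" "c < 1" using ab by (auto simp: c_def)
  have "g a \<noteq> g c"
    using inj_onD[OF simple_closed_curve_inj[OF g], of a c] c ab by auto
  then have "0 < dist (g a) (g c)" by simp
  also have "\<dots> \<le> arc_length g a c" by (rule dist_le_arc_length[OF C1]) (use c ab in auto)
  also have "\<dots> \<le> arc_length g a c + arc_length g c b"
    using order_trans[OF zero_le_dist dist_le_arc_length[OF C1, of c b]] c ab by simp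
  also have "\<dots> = arc_length g a b" by (rule arc_length_combine[OF C1]) (use c ab in auto)
  finally show ?thesis .
qed

lemma curve_dist_less:
  assumes g: "simple_closed_curve g" and "0 \<le> a" "a < b" "b < 1"
  shows "curve_dist g (g a) (g b) = min (arc_length g a b) (arc_length g b 1 + arc_length g 0 a)"
proof -
  have "curve_param g (g a) = a" "curve_param g (g b) = b"
    unfolding curve_param_def using assms by (auto intro!: the_inv_into_f_f simple_closed_curve_inj)
  then show ?thesis using assms by (simp add: curve_dist_def Let_def)
qed

lemma curve_dist_commute: "curve_dist g p q = curve_dist g q p"
  by (simp add: curve_dist_def min.commute max.commute)

lemma curve_dist_le_dilation:
  assumes "dilation g \<le> ereal \<delta>" "p \<in> path_image g" "q \<in> path_image g" "p \<noteq> q"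
  shows "curve_dist g p q \<le> \<delta> * dist p q"
proof -
  have "ereal (curve_dist g p q / dist p q) \<le> dilation g"
    unfolding dilation_def by (rule SUP_upper2[of "(p, q)"]) (use assms in auto)
  then have "curve_dist g p q / dist p q \<le> \<delta>" using assms(1) by (meson ereal_less_eq(3) order_trans)
  then show ?thesis using assms(4) by (simp add: field_simps)
qed

text \<open>If \<open>x\<close> and \<open>y\<close> have different integer parts, the estimate is
  routed through the common value \<open>f 1 = f 0\<close>.\<close>

lemma lipschitz_frac:
  fixes f :: "real \<Rightarrow> 'a::metric_space"
  assumes f: "\<And>u v. u \<in> {0..1} \<Longrightarrow> v \<in> {0..1} \<Longrightarrow> dist (f u) (f v) \<le> L * \<bar>u - v\<bar>"
    and loop: "f 0 = f 1"
  shows "dist (f (frac x)) (f (frac y)) \<le> L * \<bar>x - y\<bar>"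
proof (induction x y rule: linorder_wlog)
  case (le x y)
  have L: "0 \<le> L" using f[of 0 1] zero_le_dist[of "f 0" "f 1"] by (simp del: zero_le_dist)
  have fr: "frac t \<in> {0..1}" for t :: real using frac_lt_1[of t] by (auto intro: less_imp_le)
  show ?case
  proof (cases "\<lfloor>x\<rfloor> = \<lfloor>y\<rfloor>")
    case True
    then have "frac x - frac y = x - y" by (simp add: frac_def)
    with f[OF fr fr, of x y] show ?thesis by simp
  next
    case False
    then have "\<lfloor>x\<rfloor> + 1 \<le> \<lfloor>y\<rfloor>" using floor_mono[OF le] by simp
    then have "real_of_int \<lfloor>x\<rfloor> + 1 \<le> real_of_int \<lfloor>y\<rfloor>" by linarith
    then have le2: "(1 - frac x) + frac y \<le> y - x" by (simp add: frac_def)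
    have "dist (f (frac x)) (f (frac y)) \<le> dist (f (frac x)) (f 1) + dist (f 0) (f (frac y))"
      unfolding loop by (rule dist_triangle)
    also have "\<dots> \<le> L * (1 - frac x) + L * frac y"
      using f[OF fr, of 1 x] f[OF _ fr, of 0 y] fr[of x] fr[of y] by simp
    also have "\<dots> \<le> L * \<bar>x - y\<bar>"
      using mult_left_mono[OF le2 L] le by (simp add: algebra_simps)
    finally show ?thesis .
  qed
next
  case (sym x y)
  then show ?case by (simp add: dist_commute abs_minus_commute)
qed

section \<open>Transfer to the complex plane\<close>

text \<open>The image of the component of \<open>z\<close> is connected and misses the image of
  \<open>S\<close>, hence lies in the bounded component of \<open>\<phi> z\<close>; the isometry
  carries boundedness back.\<close>

lemma in_inside_isometry:
  fixes \<phi> :: "'a::real_normed_vector \<Rightarrow> 'b::real_normed_vector"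
  assumes "linear \<phi>" and iso: "\<And>v. norm (\<phi> v) = norm v" and z: "\<phi> z \<in> inside (\<phi> ` S)"
  shows "z \<in> inside S"
proof -
  have "\<phi> u = \<phi> v \<Longrightarrow> u = v" for u v
    using iso[of "u - v"] by (simp add: linear_diff[OF assms(1)])
  then have inj: "inj \<phi>" by (rule injI)
  have cont: "continuous_on T \<phi>" for T
    by (rule lipschitz_on_continuous_on[of 1], rule lipschitz_onI)
       (simp_all add: dist_norm iso flip: linear_diff[OF assms(1)])
  define C where "C = connected_component_set (- S) z"
  have zS: "z \<notin> S" using z by (auto simp: inside_def)
  have "\<phi> ` C \<subseteq> connected_component_set (- \<phi> ` S) (\<phi> z)"
  proof (rule connected_component_maximal)
    show "\<phi> z \<in> \<phi> ` C" using zS by (simp add: C_def)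
    show "connected (\<phi> ` C)" unfolding C_def by (intro connected_continuous_image cont) simp
    show "\<phi> ` C \<subseteq> - \<phi> ` S"
      using connected_component_subset[of "- S" z] inj by (auto simp: C_def dest: injD)
  qed
  then have "bounded (\<phi> ` C)" using z bounded_subset by (auto simp: inside_def)
  then have "bounded C" by (auto simp: bounded_iff iso)
  then show ?thesis using zS by (simp add: inside_def C_def)
qed

definition complex_of_vec :: "real^2 \<Rightarrow> complex" where
  "complex_of_vec v = Complex (v $ 1) (v $ 2)"

lemma linear_complex_of_vec: "linear complex_of_vec"
  by (rule linearI) (simp_all add: complex_of_vec_def complex_eq_iff)

lemma norm_complex_of_vec: "norm (complex_of_vec v) = norm v"
  by (simp add: complex_of_vec_def cmod_def norm_vec_def L2_set_def sum_2)

lemma dist_complex_of_vec: "dist (complex_of_vec u) (complex_of_vec v) = dist u v"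
  by (simp add: dist_norm norm_complex_of_vec flip: linear_diff[OF linear_complex_of_vec])

lemma ex_complex_of_vec: "\<exists>v. complex_of_vec v = z"
  by (rule exI[of _ "vector [Re z, Im z]"]) (simp add: complex_of_vec_def)

text \<open>The curve is traversed at constant speed \<open>L\<close> with period \<open>1\<close>; then the points at parameters
  \<open>x\<close> and \<open>x + 1/2\<close> are the halving pairs.\<close>

theorem enclosed_in_ring_of_dilation_le:
  assumes g: "simple_closed_curve g" and \<epsilon>: "0 \<le> \<epsilon>" "\<epsilon> \<le> 0.0001"
    and dil: "dilation g \<le> ereal ((1 + \<epsilon>) * (pi / 2))"
  shows "enclosed_in_ring g (1 + 3 * sqrt \<epsilon>)"
proof -
  have C1: "piecewise_C1_path g" and loop: "g 1 = g 0"
    using g by (simp_all add: simple_closed_curve_def pathfinish_def pathstart_def)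
  define s where "s = arc_length g 0"
  define L where "L = s 1"
  have s0: "s 0 = 0" by (simp add: s_def arc_length_def)
  have s_diff: "arc_length g a b = s b - s a" if "0 \<le> a" "a \<le> b" "b \<le> 1" for a b
    using arc_length_combine[OF C1, of 0 a b] that by (simp add: s_def)
  have s_less: "s a < s b" if "0 \<le> a" "a < b" "b \<le> 1" for a b
    using arc_length_pos[OF g that] s_diff[of a b] that by simp
  have L: "0 < L" using s_less[of 0 1] s0 by (simp add: L_def)
  have "\<exists>t\<in>{0..1}. s t = u" if "u \<in> {0..L}" for u
    using IVT'[of s 0 u 1] that continuous_on_arc_length[OF C1] s0 by (auto simp: L_def s_def)
  \<comment> \<open>\<tau> inverts the arc length \<open>s\<close>, which is strictly
    increasing.\<close>
  then obtain \<tau> where \<tau>: "\<And>u. u \<in> {0..L} \<Longrightarrow> \<tau> u \<in> {0..1} \<and> s (\<tau> u) = u" by metis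
  have s_inj: "a = b" if "s a = s b" "a \<in> {0..1}" "b \<in> {0..1}" for a b
    using s_less[of a b] s_less[of b a] that by (cases a b rule: linorder_cases) auto
  have s_range: "s t \<in> {0..L}" if "t \<in> {0..1}" for t
    using s_less[of 0 t] s_less[of t 1] that s0 by (cases "t = 0"; cases "t = 1") (auto simp: L_def)
  have \<tau>_less: "\<tau> u < \<tau> v" if "u \<in> {0..L}" "v \<in> {0..L}" "u < v" for u v
    using \<tau>[OF that(1)] \<tau>[OF that(2)] that(3) s_less[of "\<tau> v" "\<tau> u"]
    by (cases "\<tau> u" "\<tau> v" rule: linorder_cases) auto
  define f where "f u = complex_of_vec (g (\<tau> (L * u)))" for u
  have Lu: "L * u \<in> {0..L}" if "u \<in> {0..1}" for u
    using that L by (simp add: mult_left_le)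
  have lip: "dist (f u) (f v) \<le> L * \<bar>u - v\<bar>" if "u \<in> {0..1}" "v \<in> {0..1}" for u v
    using that
  proof (induction u v rule: linorder_wlog)
    case (le u v)
    show ?case
    proof (cases "u = v")
      case False
      then have "\<tau> (L * u) < \<tau> (L * v)" using le L by (intro \<tau>_less Lu) auto
      then have "dist (f u) (f v) \<le> arc_length g (\<tau> (L * u)) (\<tau> (L * v))"
        unfolding f_def dist_complex_of_vec using \<tau>[OF Lu] le by (intro dist_le_arc_length[OF C1]) auto
      also have "\<dots> = L * v - L * u"
        using \<tau>[OF Lu] le \<open>\<tau> (L * u) < \<tau> (L * v)\<close> by (subst s_diff) auto
      also have "\<dots> = L * \<bar>u - v\<bar>" using le by (simp add: algebra_simps)
      finally show ?thesis .
    qed simp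
  next
    case (sym u v)
    then show ?case by (simp add: dist_commute abs_minus_commute)
  qed
  have \<tau>0: "\<tau> 0 = 0" using s_inj[of "\<tau> 0" 0] \<tau>[of 0] L s0 by auto
  have \<tau>L: "\<tau> L = 1" using s_inj[of "\<tau> L" 1] \<tau>[of L] L by (auto simp: L_def)
  have f01: "f 0 = f 1" by (simp add: f_def \<tau>0 \<tau>L loop)
  \<comment> \<open>A halving pair has curve distance \<open>L / 2\<close>; dividing by the dilation
    bound \<open>(1 + \<epsilon>) * (pi / 2)\<close> gives exactly
    \<open>2 * \<rho>\<close>.\<close>
  define \<rho> where "\<rho> = L / (2 * pi * (1 + \<epsilon>))"
  have \<rho>: "0 < \<rho>" "L = 2 * pi * \<rho> * (1 + \<epsilon>)" using L \<epsilon> by (simp_all add: \<rho>_def)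
  \<comment> \<open>The strict bound \<open>u < 1/2\<close> keeps the second parameter below 1, as
    \<open>curve_dist_less\<close> demands. The other halving pairs are these with the roles
    exchanged.\<close>
  have half: "2 * \<rho> \<le> dist (f u) (f (u + 1/2))" if "0 \<le> u" "u < 1/2" for u
  proof -
    define a b where "a = \<tau> (L * u)" and "b = \<tau> (L * (u + 1/2))"
    have a: "a \<in> {0..1}" "s a = L * u" and b: "b \<in> {0..1}" "s b = L * (u + 1/2)"
      using \<tau>[OF Lu[of u]] \<tau>[OF Lu[of "u + 1/2"]] that by (auto simp: a_def b_def)
    have ab: "a < b" unfolding a_def b_def by (rule \<tau>_less[OF Lu Lu]) (use that L in auto)
    have "b \<noteq> 1" using b(2) that L by (auto simp: L_def[symmetric])
    then have b1: "b < 1" using b(1) by simp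
    have "curve_dist g (g a) (g b) = L / 2"
      using a b ab b1 L by (simp add: curve_dist_less[OF g] s_diff s0 algebra_simps flip: L_def)
    moreover have "curve_dist g (g a) (g b) \<le> (1 + \<epsilon>) * (pi / 2) * dist (g a) (g b)"
    proof (rule curve_dist_le_dilation[OF dil])
      show "g a \<noteq> g b" using inj_onD[OF simple_closed_curve_inj[OF g], of a b] a b ab b1 by auto
    qed (use a b in \<open>auto simp: path_image_def\<close>)
    ultimately have "(1 + \<epsilon>) * (pi / 2) * (2 * \<rho>) \<le> (1 + \<epsilon>) * (pi / 2) * dist (g a) (g b)"
      by (simp add: \<rho>(2) algebra_simps)
    then have "2 * \<rho> \<le> dist (g a) (g b)" by (rule mult_left_le_imp_le) (use \<epsilon> in simp)
    then show ?thesis by (simp add: f_def dist_complex_of_vec a_def b_def)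
  qed
  define \<gamma> where "\<gamma> x = f (frac x)" for x
  interpret halving_curve \<gamma> L \<rho>
  proof
    show "\<gamma> (x + 1) = \<gamma> x" for x by (simp add: \<gamma>_def frac_def)
    show "cmod (\<gamma> x - \<gamma> y) \<le> L * \<bar>x - y\<bar>" for x y
      using lipschitz_frac[of f, OF lip f01] by (simp add: \<gamma>_def flip: dist_norm)
    show "2 * \<rho> \<le> cmod (\<gamma> x - \<gamma> (x + 1/2))" for x
    proof (cases "frac x < 1/2")
      case True
      then have "frac (x + 1/2) = frac x + 1/2" by (simp add: frac_eq frac_add)
      then show ?thesis using half[of "frac x"] True by (simp add: \<gamma>_def dist_norm)
    next
      case False
      then have "frac (x + 1/2) = frac x - 1/2" by (simp add: frac_eq frac_add)
      then show ?thesis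
        using half[of "frac x - 1/2"] False frac_lt_1[of x] by (simp add: \<gamma>_def dist_norm norm_minus_commute)
    qed
  qed (fact \<rho>(1))
  obtain z' r where ring: "0 < r" "z' \<in> inside (\<gamma> ` {0..1})"
    "\<And>x. r \<le> cmod (\<gamma> x - z')" "\<And>x. cmod (\<gamma> x - z') \<le> (1 + 3 * sqrt \<epsilon>) * r"
    using ex_ring[OF eq_refl[OF \<rho>(2)] \<epsilon>] by metis
  obtain z where z: "complex_of_vec z = z'" using ex_complex_of_vec by blast
  \<comment> \<open>The end point \<open>t = 1\<close> is separate because \<open>frac\<close> sends
    1 to 0.\<close>
  have point: "\<exists>x\<in>{0..1}. \<gamma> x = complex_of_vec (g t)" if "t \<in> {0..1}" for t
  proof (cases "t = 1")
    case True
    then show ?thesis by (intro bexI[of _ 0]) (simp_all add: \<gamma>_def f_def \<tau>0 loop)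
  next
    case False
    have "\<tau> (s t) = t" using s_inj \<tau>[OF s_range[OF that]] that by blast
    moreover have "s t / L \<in> {0..<1}"
      using s_range[OF that] s_less[of t 1] that False L by (auto simp flip: L_def)
    ultimately show ?thesis
      using L by (intro bexI[of _ "s t / L"]) (auto simp: \<gamma>_def f_def frac_eq)
  qed
  have image: "\<gamma> ` {0..1} = complex_of_vec ` path_image g"
  proof (intro equalityI subsetI)
    fix y assume "y \<in> \<gamma> ` {0..1}"
    then obtain x where "y = f (frac x)" by (auto simp: \<gamma>_def)
    moreover have "\<tau> (L * frac x) \<in> {0..1}" using \<tau> Lu[of "frac x"] frac_lt_1[of x] by auto
    ultimately show "y \<in> complex_of_vec ` path_image g" by (auto simp: f_def path_image_def)
  qed (use point in \<open>force simp: path_image_def\<close>)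
  have dist_g: "r \<le> dist z p \<and> dist z p \<le> (1 + 3 * sqrt \<epsilon>) * r" if "p \<in> path_image g" for p
  proof -
    from that obtain t where "t \<in> {0..1}" "p = g t" by (auto simp: path_image_def)
    with point obtain x where "\<gamma> x = complex_of_vec p" by blast
    then have "dist z p = cmod (\<gamma> x - z')"
      using dist_complex_of_vec[of z p] by (simp add: z dist_norm norm_minus_commute)
    with ring(3,4)[of x] show ?thesis by simp
  qed
  have "z \<in> inside (path_image g)"
    by (rule in_inside_isometry[OF linear_complex_of_vec norm_complex_of_vec]) (use ring(2) z image in simp)
  moreover have "ball z r \<subseteq> - path_image g"
  proof
    fix p assume "p \<in> ball z r"
    then show "p \<in> - path_image g" using dist_g[of p] by (cases "p \<in> path_image g") simp_all
  qed
  \<comment> \<open>The ball is convex and misses the curve, so all of it lies in the component of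
    its centre.\<close>
  then have "connected_component (- path_image g) z p" if "p \<in> ball z r" for p
    using that ring(1) by (intro connected_componentI[OF convex_connected[OF convex_ball]]) auto
  ultimately have "ball z r \<subseteq> inside (path_image g)" using inside_same_component by blast
  moreover have "path_image g \<subseteq> eta_ring (1 + 3 * sqrt \<epsilon>) z r"
    using dist_g unfolding eta_ring_def by blast
  ultimately show ?thesis using ring(1) unfolding enclosed_in_ring_def by blast
qed

section \<open>Sharpness\<close>

text \<open>The velocity of \<open>bump\<close> is \<open>cos (3 t) cis t\<close>, radial where the circle moves tangentially.
  So \<open>t\<close> and \<open>t + \<pi>\<close> have equal speed on the perturbed circle and remain halving pairs at
  distance \<open>2\<close>, and the length grows only quadratically in the size of the perturbation.\<close>

definition bump :: "real \<Rightarrow> complex" where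
  "bump t = \<i> * (cis (- 2 * t) / 4 - cis (4 * t) / 8)"

definition wobble :: "real \<Rightarrow> real \<Rightarrow> complex" where
  "wobble s t = cis t + of_real s * bump t"

lemma cis_plus_pi: "cis (t + pi) = - cis t"
  by (simp add: complex_eq_iff)

text \<open>Both frequencies, -2 and 4, are even.\<close>

lemma bump_plus_pi: "bump (t + pi) = bump t"
proof -
  have "cis (- 2 * (t + pi)) = cis (- 2 * t) * cis (- (2 * pi))"
    by (simp add: cis_mult algebra_simps)
  moreover have "cis (4 * (t + pi)) = cis (4 * t) * cis (2 * pi) * cis (2 * pi)"
    by (simp only: cis_mult) (simp add: algebra_simps)
  ultimately show ?thesis unfolding bump_def by (simp add: complex_eq_iff)
qed

lemma wobble_plus_2pi: "wobble s (t + 2 * pi) = wobble s t"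
  using bump_plus_pi[of "t + pi"] cis_plus_pi[of "t + pi"]
  by (simp add: wobble_def bump_plus_pi cis_plus_pi add.assoc)

text \<open>The velocity \<open>cos (3 * t) * cis t\<close> is the mean of
  \<open>cis (- 2 * t)\<close> and \<open>cis (4 * t)\<close>; termwise integration produces the
  coefficients \<open>1/4\<close> and \<open>1/8\<close> of \<open>bump\<close>.\<close>

lemma bump_has_vector_derivative:
  "(bump has_vector_derivative of_real (cos (3 * t)) * cis t) (at t within S)"
proof -
  have "cis (4 * t) = cis t * cis (3 * t)" "cis (- 2 * t) = cis t * cis (- (3 * t))"
    by (simp_all add: cis_mult)
  moreover have "cis (- (3 * t)) + cis (3 * t) = 2 * of_real (cos (3 * t))"
    by (simp add: complex_eq_iff)
  moreover have "\<i> * ((- 2) *\<^sub>R (\<i> * cis (- 2 * t)) / 4 - 4 *\<^sub>R (\<i> * cis (4 * t)) / 8)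
      = (cis (- 2 * t) + cis (4 * t)) / 2"
    by (simp add: complex_eq_iff)
  ultimately have 1: "\<i> * ((- 2) *\<^sub>R (\<i> * cis (- 2 * t)) / 4 - 4 *\<^sub>R (\<i> * cis (4 * t)) / 8)
      = of_real (cos (3 * t)) * cis t"
    by (simp flip: distrib_left)
  have cis: "((\<lambda>t. cis (c * t)) has_vector_derivative c *\<^sub>R (\<i> * cis (c * t))) (at t within S)" for c t
  proof -
    have "((\<lambda>x. c * x) has_derivative (\<lambda>h. h * c)) (at t within S)"
      by (auto intro!: derivative_eq_intros simp: mult.commute)
    from has_derivative_cis[OF this] show ?thesis
      unfolding has_vector_derivative_def by simp
  qed
  show ?thesis
    unfolding bump_def 1[symmetric]
    by (intro has_vector_derivative_mult_right has_vector_derivative_diff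
        bounded_linear.has_vector_derivative[OF bounded_linear_divide] cis)
qed

lemma wobble_has_vector_derivative:
  "(wobble s has_vector_derivative cis t * (\<i> + of_real (s * cos (3 * t)))) (at t within S)"
proof -
  have "(cis has_vector_derivative \<i> * cis t) (at t within S)"
    unfolding has_vector_derivative_def using has_derivative_cis[of "\<lambda>x. x" "\<lambda>h. h" t S] by simp
  from has_vector_derivative_add[OF this has_vector_derivative_mult_right[OF bump_has_vector_derivative, of "of_real s"]]
  show ?thesis unfolding wobble_def by (simp add: algebra_simps)
qed

lemma bump_lipschitz: "cmod (bump t - bump u) \<le> \<bar>t - u\<bar>"
proof -
  have "cmod (bump t - bump u) \<le> 1 * norm (t - u)"
  proof (rule differentiable_bound)
    show "(bump has_derivative (\<lambda>h. h *\<^sub>R (of_real (cos (3 * x)) * cis x))) (at x within UNIV)" for x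
      using bump_has_vector_derivative[of x UNIV] by (simp add: has_vector_derivative_def)
    show "onorm (\<lambda>h. h *\<^sub>R (of_real (cos (3 * x)) * cis x)) \<le> 1" for x
      by (rule onorm_le) (simp add: norm_mult mult_left_le)
  qed auto
  then show ?thesis by simp
qed

text \<open>The unit circle chord \<open>2 * sin (\<sigma> / 2)\<close> exceeds
  \<open>2 * \<sigma> / pi\<close> except at 0 and \<open>pi\<close>, where they agree. The loss
  from the perturbation must therefore vanish at both ends, hence the minimum; it is beaten there by
  a linear slack.\<close>

lemma half_angle_margin:
  assumes \<sigma>: "0 \<le> \<sigma>" "\<sigma> \<le> pi" and s: "0 \<le> s" "s \<le> 1/100"
  shows "\<sigma> \<le> pi / 2 * (2 * sin (\<sigma> / 2) - s * min \<sigma> (pi - \<sigma>))"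
proof (cases "\<sigma> \<le> pi / 2")
  case True
  define y where "y = \<sigma> / 2"
  have y: "0 \<le> y" "y \<le> 4/5" using True \<sigma> pi_approx by (auto simp: y_def)
  have "\<bar>sin y - (\<Sum>i<3. sin_coeff i * y ^ i)\<bar> \<le> inverse (fact 3) * \<bar>y\<bar> ^ 3"
    by (rule Maclaurin_sin_bound)
  then have "\<bar>sin y - y\<bar> \<le> y ^ 3 / 6"
    using y by (simp add: numeral_3_eq_3 sin_coeff_def fact_numeral)
  then have "y - sin y \<le> y ^ 3 / 6" by linarith
  moreover have "y ^ 3 \<le> 16/25 * y"
    using mult_right_mono[OF power_mono[OF y(2) y(1), of 2] y(1)] by (simp add: power3_eq_cube power2_eq_square)
  ultimately have "22/25 * y \<le> sin y" using y by linarith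
  moreover have "s * min \<sigma> (pi - \<sigma>) \<le> 1/100 * (2 * y)"
    by (rule mult_mono) (use s \<sigma> in \<open>simp_all add: y_def\<close>)
  \<comment> \<open>\<open>2 * 22/25\<close> from the sine, less \<open>1/50\<close> for the
    perturbation.\<close>
  ultimately have 1: "87/50 * y \<le> 2 * sin (\<sigma> / 2) - s * min \<sigma> (pi - \<sigma>)" unfolding y_def by linarith
  have "\<sigma> \<le> 3/2 * (87/50 * y)" using y(1) by (simp add: y_def)
  also have "\<dots> \<le> pi / 2 * (2 * sin (\<sigma> / 2) - s * min \<sigma> (pi - \<sigma>))"
    by (rule mult_mono[OF _ 1]) (use y pi_gt3 in simp_all)
  finally show ?thesis .
next
  case False
  define z where "z = pi / 2 - \<sigma> / 2"
  have z: "0 \<le> z" "z \<le> 4/5" using False \<sigma> pi_approx by (auto simp: z_def)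
  have "(sin (z / 2))\<^sup>2 \<le> (z / 2)\<^sup>2"
    using abs_sin_x_le_abs_x[of "z / 2"] by (rule abs_le_square_iff[THEN iffD1])
  then have "1 - z\<^sup>2 / 2 \<le> cos z"
    using cos_double_sin[of "z / 2"] by (simp add: power_divide)
  moreover have "cos z = sin (\<sigma> / 2)" by (simp add: z_def cos_diff)
  moreover have "z\<^sup>2 \<le> 4/5 * z" using mult_right_mono[OF z(2,1)] by (simp add: power2_eq_square)
  moreover have "s * min \<sigma> (pi - \<sigma>) \<le> 1/100 * (2 * z)"
    by (rule mult_mono) (use s \<sigma> in \<open>simp_all add: z_def\<close>)
  \<comment> \<open>The loss is \<open>z^2\<close>, at most \<open>4/5 * z\<close>, plus
    \<open>1/50 * z\<close> for the perturbation.\<close>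
  ultimately have 1: "2 - 41/50 * z \<le> 2 * sin (\<sigma> / 2) - s * min \<sigma> (pi - \<sigma>)" by linarith
  have "41/50 * (pi * z) \<le> 4 * z"
    using mult_right_mono[of pi 4 z] pi_less_4 z by linarith
  moreover have "pi / 2 * (2 - 41/50 * z) = pi - 1/2 * (41/50 * (pi * z))" by (simp add: field_simps)
  moreover have "\<sigma> = pi - 2 * z" by (simp add: z_def)
  ultimately have "\<sigma> \<le> pi / 2 * (2 - 41/50 * z)" by linarith
  also have "\<dots> \<le> pi / 2 * (2 * sin (\<sigma> / 2) - s * min \<sigma> (pi - \<sigma>))"
    by (rule mult_left_mono[OF 1]) simp
  finally show ?thesis .
qed

text \<open>The parameter distance stands in for the length of the shorter arc, which exceeds it at
  most by the factor \<open>1 + s^2 / 2\<close>.\<close>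

lemma wobble_chord:
  assumes s: "0 \<le> s" "s \<le> 1/100" and tu: "\<bar>u - t\<bar> \<le> pi"
  shows "\<bar>u - t\<bar> \<le> pi / 2 * cmod (wobble s u - wobble s t)"
  using tu
proof (induction t u rule: linorder_wlog)
  case (le t u)
  define \<sigma> where "\<sigma> = u - t"
  have \<sigma>: "0 \<le> \<sigma>" "\<sigma> \<le> pi" using le by (simp_all add: \<sigma>_def)
  \<comment> \<open>By periodicity the increment can also be measured from \<open>u - pi\<close>, so
    it is small for nearly antipodal points as well.\<close>
  have "cmod (bump u - bump t) \<le> min \<sigma> (pi - \<sigma>)"
    using bump_lipschitz[of u t] bump_lipschitz[of "u - pi" t] bump_plus_pi[of "u - pi"] \<sigma>
    by (auto simp: \<sigma>_def min_def abs_real_def split: if_splits)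
  then have b: "cmod (of_real s * (bump u - bump t)) \<le> s * min \<sigma> (pi - \<sigma>)"
    using s by (simp add: norm_mult mult_left_mono)
  have "(cmod (cis u - cis t))\<^sup>2 = (2 * sin (\<sigma> / 2))\<^sup>2"
    using cmod_diff_polar[of 1 u 1 t] by (simp add: \<sigma>_def power_mult_distrib)
  moreover have "0 \<le> sin (\<sigma> / 2)" using \<sigma> by (intro sin_ge_zero) auto
  ultimately have "cmod (cis u - cis t) = 2 * sin (\<sigma> / 2)" by (intro power2_eq_imp_eq[of _ "2 * sin _"]) simp_all
  moreover have "wobble s u - wobble s t = (cis u - cis t) + of_real s * (bump u - bump t)"
    by (simp add: wobble_def algebra_simps)
  ultimately have "2 * sin (\<sigma> / 2) - s * min \<sigma> (pi - \<sigma>) \<le> cmod (wobble s u - wobble s t)"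
    using norm_diff_ineq[of "cis u - cis t" "of_real s * (bump u - bump t)"] b by simp
  then have "pi / 2 * (2 * sin (\<sigma> / 2) - s * min \<sigma> (pi - \<sigma>)) \<le> pi / 2 * cmod (wobble s u - wobble s t)"
    by (rule mult_left_mono) simp
  with half_angle_margin[OF \<sigma> s] have "\<sigma> \<le> pi / 2 * cmod (wobble s u - wobble s t)" by (rule order_trans)
  moreover have "\<bar>u - t\<bar> = \<sigma>" using le by (simp add: \<sigma>_def)
  ultimately show ?case by (simp only:)
next
  case (sym t u)
  then show ?case by (simp add: abs_minus_commute norm_minus_commute)
qed

section \<open>The perturbed circle as a simple closed curve of small dilation\<close>

definition vec_of_complex :: "complex \<Rightarrow> real^2" where
  "vec_of_complex z = vector [Re z, Im z]"

lemma bounded_linear_vec_of_complex: "bounded_linear vec_of_complex"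
  by (rule linear_conv_bounded_linear[THEN iffD1], rule linearI)
     (simp_all add: vec_of_complex_def vec_eq_iff forall_2)

lemma complex_of_vec_of_complex [simp]: "complex_of_vec (vec_of_complex z) = z"
  by (simp add: complex_of_vec_def vec_of_complex_def)

lemma norm_vec_of_complex: "norm (vec_of_complex z) = cmod z"
  by (metis complex_of_vec_of_complex norm_complex_of_vec)

lemma dist_vec_of_complex: "dist (vec_of_complex z) v = cmod (z - complex_of_vec v)"
  by (metis complex_of_vec_of_complex dist_complex_of_vec dist_norm)

definition wobble_curve :: "real \<Rightarrow> real \<Rightarrow> real^2" where
  "wobble_curve s x = vec_of_complex (wobble s (2 * pi * x))"

lemma wobble_curve_has_vector_derivative:
  "(wobble_curve s has_vector_derivative
     vec_of_complex ((2 * pi) *\<^sub>R (cis (2 * pi * x) * (\<i> + of_real (s * cos (3 * (2 * pi * x))))))) (at x within S)"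
proof -
  have "((\<lambda>x. 2 * pi * x) has_vector_derivative 2 * pi) (at x within S)"
    by (auto intro!: derivative_eq_intros simp flip: has_real_derivative_iff_has_vector_derivative)
  from vector_diff_chain_within[OF this wobble_has_vector_derivative]
  have "((\<lambda>x. wobble s (2 * pi * x)) has_vector_derivative
     (2 * pi) *\<^sub>R (cis (2 * pi * x) * (\<i> + of_real (s * cos (3 * (2 * pi * x)))))) (at x within S)"
    by (simp add: o_def)
  from bounded_linear.has_vector_derivative[OF bounded_linear_vec_of_complex this]
  show ?thesis unfolding wobble_curve_def .
qed

lemma speed_at_wobble_curve_le:
  "speed_at (wobble_curve s) x \<le> 2 * pi * (1 + s\<^sup>2 / 2)"
proof -
  have "(cmod (\<i> + of_real (s * cos (3 * (2 * pi * x)))))\<^sup>2 = 1 + s\<^sup>2 * (cos (3 * (2 * pi * x)))\<^sup>2"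
    by (simp add: cmod_power2 power_mult_distrib)
  also have "\<dots> \<le> 1 + s\<^sup>2"
    by (simp add: mult_left_le abs_square_le_1)
  also have "\<dots> \<le> (1 + s\<^sup>2 / 2)\<^sup>2" by (simp add: power2_sum)
  finally have "cmod (\<i> + of_real (s * cos (3 * (2 * pi * x)))) \<le> 1 + s\<^sup>2 / 2"
    by (rule power2_le_imp_le) simp
  then show ?thesis
    unfolding speed_at_def vector_derivative_at[OF wobble_curve_has_vector_derivative]
    by (simp add: norm_vec_of_complex norm_mult mult_left_mono)
qed

lemma piecewise_C1_wobble_curve: "piecewise_C1_path (wobble_curve s)"
  unfolding piecewise_C1_path_def
proof (intro conjI exI[of _ "{0, 1}"] ballI impI)
  show "path (wobble_curve s)"
    unfolding path_def
    by (rule continuous_on_vector_derivative[OF wobble_curve_has_vector_derivative])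
next
  fix a b :: real
  have "continuous_on {a..b} (\<lambda>x. vec_of_complex ((2 * pi) *\<^sub>R (cis (2 * pi * x) * (\<i> + of_real (s * cos (3 * (2 * pi * x)))))))"
    by (intro bounded_linear.continuous_on[OF bounded_linear_vec_of_complex] continuous_intros)
  then show "\<exists>D. continuous_on {a..b} D \<and>
      (\<forall>t\<in>{a..b}. (wobble_curve s has_vector_derivative D t) (at t within {a..b}))"
    using wobble_curve_has_vector_derivative by blast
qed auto

lemma arc_length_wobble_curve_le:
  assumes "0 \<le> a" "a \<le> b" "b \<le> 1"
  shows "arc_length (wobble_curve s) a b \<le> 2 * pi * (1 + s\<^sup>2 / 2) * (b - a)"
proof -
  have "integral {a..b} (speed_at (wobble_curve s)) \<le> integral {a..b} (\<lambda>_. 2 * pi * (1 + s\<^sup>2 / 2))"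
    by (intro integral_le speed_integrable piecewise_C1_wobble_curve speed_at_wobble_curve_le)
       (use assms in auto)
  then show ?thesis using assms by (simp add: arc_length_eq mult_ac)
qed

lemma wobble_curve_chord:
  assumes s: "0 \<le> s" "s \<le> 1/100" and xy: "0 \<le> x" "x \<le> y" "y \<le> 1"
  shows "2 * pi * min (y - x) (1 - (y - x)) \<le> pi / 2 * dist (wobble_curve s x) (wobble_curve s y)"
proof (cases "y - x \<le> 1/2")
  case True
  have eq: "2 * pi * y - 2 * pi * x = 2 * pi * (y - x)" by (rule right_diff_distrib[symmetric])
  have "\<bar>2 * pi * y - 2 * pi * x\<bar> = 2 * pi * (y - x)" unfolding eq using xy by (simp add: abs_mult)
  moreover have "2 * pi * (y - x) \<le> 2 * pi * (1/2)" using True by (intro mult_left_mono) auto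
  ultimately have "2 * pi * (y - x) \<le> pi / 2 * cmod (wobble s (2 * pi * y) - wobble s (2 * pi * x))"
    using wobble_chord[OF s, of "2 * pi * y" "2 * pi * x"] by simp
  then show ?thesis
    using True by (simp add: wobble_curve_def dist_vec_of_complex norm_minus_commute min_def)
next
  case False
  \<comment> \<open>The shorter way leads from \<open>y\<close> through the closing point to
    \<open>x\<close>, one period further on.\<close>
  have eq: "(2 * pi * x + 2 * pi) - 2 * pi * y = 2 * pi * (1 - (y - x))" by (simp add: algebra_simps)
  have "\<bar>(2 * pi * x + 2 * pi) - 2 * pi * y\<bar> = 2 * pi * (1 - (y - x))"
    unfolding eq using xy by (simp add: abs_mult)
  moreover have "2 * pi * (1 - (y - x)) \<le> 2 * pi * (1/2)" using False by (intro mult_left_mono) auto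
  ultimately have "2 * pi * (1 - (y - x)) \<le> pi / 2 * cmod (wobble s (2 * pi * x + 2 * pi) - wobble s (2 * pi * y))"
    using wobble_chord[OF s, of "2 * pi * x + 2 * pi" "2 * pi * y"] by simp
  then show ?thesis
    using False by (simp add: wobble_curve_def dist_vec_of_complex wobble_plus_2pi min_def)
qed

text \<open>Injectivity is read off the chord bound: equal points force the cyclic parameter
  distance to be 0.\<close>

lemma simple_closed_wobble_curve:
  assumes s: "0 \<le> s" "s \<le> 1/100"
  shows "simple_closed_curve (wobble_curve s)"
proof -
  have *: "x = y \<or> x = 0 \<and> y = 1" if "0 \<le> x" "x \<le> y" "y \<le> 1" "wobble_curve s x = wobble_curve s y" for x y
    using wobble_curve_chord[OF s that(1-3)] that by (auto simp: mult_le_0_iff min_def not_le[THEN iffD2, OF pi_gt_zero] split: if_splits)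
  have "loop_free (wobble_curve s)"
    unfolding loop_free_def
  proof (intro ballI impI)
    fix x y :: real
    assume xy: "x \<in> {0..1}" "y \<in> {0..1}" "wobble_curve s x = wobble_curve s y"
    show "x = y \<or> x = 0 \<and> y = 1 \<or> x = 1 \<and> y = 0"
    proof (cases "x \<le> y")
      case True
      then have "x = y \<or> x = 0 \<and> y = 1" using xy by (intro *) simp_all
      then show ?thesis by blast
    next
      case False
      then have "y = x \<or> y = 0 \<and> x = 1" using xy by (intro *) simp_all
      then show ?thesis by blast
    qed
  qed
  moreover have "wobble_curve s 1 = wobble_curve s 0"
    using wobble_plus_2pi[of s 0] by (simp add: wobble_curve_def)
  ultimately show ?thesis
    using piecewise_C1_wobble_curve[of s]
    by (auto simp: simple_closed_curve_def simple_path_def piecewise_C1_path_def pathfinish_def pathstart_def)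
qed

lemma dilation_wobble_curve_le:
  assumes s: "0 \<le> s" "s \<le> 1/100"
  shows "dilation (wobble_curve s) \<le> ereal ((1 + s\<^sup>2) * (pi / 2))"
proof -
  let ?g = "wobble_curve s"
  have less: "curve_dist ?g (?g x) (?g y) \<le> (1 + s\<^sup>2) * (pi / 2) * dist (?g x) (?g y)"
    if "0 \<le> x" "x < y" "y < 1" for x y
  proof -
    have "arc_length ?g x y \<le> 2 * pi * (1 + s\<^sup>2 / 2) * (y - x)"
      using that by (intro arc_length_wobble_curve_le) auto
    moreover have "arc_length ?g y 1 + arc_length ?g 0 x \<le> 2 * pi * (1 + s\<^sup>2 / 2) * (1 - (y - x))"
      using arc_length_wobble_curve_le[of y 1 s] arc_length_wobble_curve_le[of 0 x s] that
      by (simp add: algebra_simps)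
    ultimately have "curve_dist ?g (?g x) (?g y) \<le> 2 * pi * (1 + s\<^sup>2 / 2) * min (y - x) (1 - (y - x))"
      using that unfolding curve_dist_less[OF simple_closed_wobble_curve[OF s] that] min_def by auto
    also have "\<dots> = (1 + s\<^sup>2 / 2) * (2 * pi * min (y - x) (1 - (y - x)))" by simp
    also have "\<dots> \<le> (1 + s\<^sup>2) * (pi / 2 * dist (?g x) (?g y))"
      using that by (intro mult_mono wobble_curve_chord[OF s]) auto
    finally show ?thesis by (simp add: mult.assoc)
  qed
  have "curve_dist ?g p q / dist p q \<le> (1 + s\<^sup>2) * (pi / 2)"
    if pq: "p \<in> path_image ?g" "q \<in> path_image ?g" "p \<noteq> q" for p q
  proof -
    have param: "\<exists>x. 0 \<le> x \<and> x < 1 \<and> p = ?g x" if p: "p \<in> path_image ?g" for p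
    proof -
      obtain x where x: "0 \<le> x" "x \<le> 1" "p = ?g x" using p by (auto simp: path_image_def)
      have "?g 1 = ?g 0" using wobble_plus_2pi[of s 0] by (simp add: wobble_curve_def)
      then show ?thesis using x by (cases "x = 1") auto
    qed
    obtain x y where x: "0 \<le> x" "x < 1" "p = ?g x" and y: "0 \<le> y" "y < 1" "q = ?g y"
      using param[OF pq(1)] param[OF pq(2)] by blast
    have "x \<noteq> y" using x y pq(3) by auto
    then have "curve_dist ?g p q \<le> (1 + s\<^sup>2) * (pi / 2) * dist p q"
      using less[of x y] less[of y x] x y by (cases "x < y") (auto simp: curve_dist_commute dist_commute)
    then show ?thesis using pq(3) by (simp add: divide_le_eq)
  qed
  then show ?thesis unfolding dilation_def by (intro SUP_least) auto
qed

text \<open>The radial displacement has frequency 3, whereas moving the centre of a ring has a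
  radial effect of frequency 1 and cannot compensate it.\<close>

lemma Re_bump_radial: "Re (bump t * cnj (cis t)) = 3 / 8 * sin (3 * t)"
proof -
  have "bump t * cnj (cis t) = \<i> * (cis (- (3 * t)) / 4 - cis (3 * t) / 8)"
    by (simp add: bump_def cis_cnj algebra_simps cis_mult)
  then show ?thesis by simp
qed

text \<open>Squared distances of antipodal points from \<open>z\<close> differ by four times the radial part of
  \<open>s bump t - z\<close>. At \<open>\<pi>/6\<close>, \<open>\<pi>/2\<close>, \<open>5\<pi>/6\<close> with signs \<open>+, -, +\<close> the contribution of \<open>z\<close> cancels.\<close>

lemma wobble_curve_not_enclosed:
  assumes s: "0 < s" "s \<le> 1/100"
  shows "\<not> enclosed_in_ring (wobble_curve s) (1 + 1/2 * s)"
proof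
  assume "enclosed_in_ring (wobble_curve s) (1 + 1/2 * s)"
  then obtain z r where r: "0 < r" and ring: "path_image (wobble_curve s) \<subseteq> eta_ring (1 + 1/2 * s) z r"
    and inside: "ball z r \<subseteq> inside (path_image (wobble_curve s))"
    unfolding enclosed_in_ring_def by blast
  define Z where "Z = complex_of_vec z"
  have bump_le: "cmod (bump t) \<le> 1" for t
  proof -
    have "cmod (bump t) \<le> cmod (cis (- 2 * t) / 4) + cmod (cis (4 * t) / 8)"
      unfolding bump_def norm_mult norm_ii mult_1 by (rule norm_triangle_ineq4)
    then show ?thesis by (simp add: norm_divide)
  qed
  have norm_wobble: "cmod (wobble s t) \<le> 1 + s" for t
  proof -
    have "s * cmod (bump t) \<le> s" using s bump_le[of t] by (simp add: mult_left_le)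
    moreover have "cmod (wobble s t) \<le> 1 + s * cmod (bump t)"
      using norm_triangle_ineq[of "cis t" "of_real s * bump t"] s by (simp add: wobble_def norm_mult)
    ultimately show ?thesis by linarith
  qed
  \<comment> \<open>The hole is inside the curve and the curve lies in this convex disc, so the disc
    contains the hole and bounds \<open>r\<close>.\<close>
  have "path_image (wobble_curve s) \<subseteq> cball 0 (101/100)"
  proof (intro subsetI)
    fix p assume "p \<in> path_image (wobble_curve s)"
    then obtain x where "p = wobble_curve s x" unfolding path_image_def by blast
    then have "norm p \<le> 1 + s" using norm_wobble by (simp add: wobble_curve_def norm_vec_of_complex)
    then show "p \<in> cball 0 (101/100)" using s by simp
  qed
  then have "- cball 0 (101/100) \<subseteq> outside (path_image (wobble_curve s))"
    by (intro outside_subset_convex) auto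
  then have "ball z r \<subseteq> cball 0 (101/100)"
    using inside inside_Int_outside[of "path_image (wobble_curve s)"] by blast
  then have r2: "r \<le> (101/100)"
    using r zero_le_dist[of z 0] unfolding ball_subset_cball_iff by linarith
  have dist: "r \<le> cmod (wobble s t - Z) \<and> cmod (wobble s t - Z) \<le> (1 + 1/2 * s) * r" for t
  proof -
    obtain y where y: "0 \<le> y" "y \<le> 2 * pi" "wobble s y = wobble s t"
      by (rule periodic_representative[of "wobble s" "2 * pi" t, OF wobble_plus_2pi]) simp_all
    have "wobble_curve s (y / (2 * pi)) \<in> path_image (wobble_curve s)"
      using y by (auto simp: path_image_def)
    then have "wobble_curve s (y / (2 * pi)) \<in> eta_ring (1 + 1/2 * s) z r" using ring by blast
    then show ?thesis
      by (simp add: eta_ring_def dist_commute[of z] wobble_curve_def dist_vec_of_complex y(3) Z_def)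
  qed
  define f where "f t = Re ((of_real s * bump t - Z) * cnj (cis t))" for t
  \<comment> \<open>Both distances lie between the radii of the ring, so \<open>4 * f t\<close> is
    bounded by the difference of the squared radii; \<open>11/10\<close> covers
    \<open>r \<le> 101/100\<close> and the quadratic term in \<open>s\<close>.\<close>
  have bound: "4 * \<bar>f t\<bar> \<le> 11/10 * s" for t
  proof -
    have "4 * f t = (cmod (wobble s t - Z))\<^sup>2 - (cmod (wobble s (t + pi) - Z))\<^sup>2"
      unfolding wobble_def bump_plus_pi cis_plus_pi f_def cmod_power2
      by (simp add: power2_eq_square algebra_simps)
    moreover have "r\<^sup>2 \<le> (cmod (wobble s x - Z))\<^sup>2 \<and> (cmod (wobble s x - Z))\<^sup>2 \<le> ((1 + 1/2 * s) * r)\<^sup>2" for x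
      using dist[of x] r by (intro conjI power_mono) auto
    ultimately have "4 * \<bar>f t\<bar> \<le> ((1 + 1/2 * s) * r)\<^sup>2 - r\<^sup>2"
      by (smt (verit))
    also have "\<dots> = r\<^sup>2 * (s + s\<^sup>2 / 4)" by (simp add: power2_eq_square algebra_simps)
    also have "\<dots> \<le> (101/100)\<^sup>2 * (s + s / 400)"
      using r r2 s by (intro mult_mono power_mono add_mono divide_right_mono) (auto simp: power2_eq_square)
    also have "\<dots> \<le> 11/10 * s" using s by (simp add: power2_eq_square)
    finally show ?thesis .
  qed
  have f: "f t = 3 / 8 * s * sin (3 * t) - (Re Z * cos t + Im Z * sin t)" for t
  proof -
    have "f t = s * Re (bump t * cnj (cis t)) - Re (Z * cnj (cis t))"
      by (simp add: f_def algebra_simps)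
    then show ?thesis unfolding Re_bump_radial by simp
  qed
  have "cos (5 * pi / 6) = - cos (pi / 6)" "sin (5 * pi / 6) = sin (pi / 6)"
    using cos_pi_minus[of "pi / 6"] sin_pi_minus[of "pi / 6"] by (simp_all add: field_simps)
  moreover have "sin (3 * (pi / 6)) = 1" by simp
  moreover have "sin (3 * (pi / 2)) = - 1" using sin_3over2_pi by simp
  moreover have "sin (3 * (5 * pi / 6)) = 1"
    using sin_periodic[of "pi / 2"] by (simp add: field_simps)
  \<comment> \<open>Each point contributes \<open>3/8 * s\<close>. Four times the sum is
    \<open>4.5 * s\<close>, against at most \<open>3.3 * s\<close> from
    \<open>bound\<close>.\<close>
  ultimately have "f (pi / 6) - f (pi / 2) + f (5 * pi / 6) = 9 / 8 * s"
    unfolding f by (simp only: sin_30 cos_pi_half sin_pi_half)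
  moreover have "4 * (a - b + c) \<le> 3 * k"
    if "4 * \<bar>a\<bar> \<le> k" "4 * \<bar>b\<bar> \<le> k" "4 * \<bar>c\<bar> \<le> k" for a b c k :: real
    using that by (simp add: abs_if split: if_splits)
  from this[OF bound bound bound]
  have "4 * (f (pi / 6) - f (pi / 2) + f (5 * pi / 6)) \<le> 3 * (11/10 * s)" .
  ultimately show False using s by simp
qed

theorem lemma6:
  shows "(\<forall>(g :: real \<Rightarrow> real^2) (\<epsilon> :: real).
            simple_closed_curve g \<and> 0 \<le> \<epsilon> \<and> \<epsilon> \<le> 0.0001 \<and>
            dilation g \<le> ereal ((1 + \<epsilon>) * (pi / 2)) \<longrightarrow>
            enclosed_in_ring g (1 + 3 * sqrt \<epsilon>)) \<and>
         (\<exists>c > (0 :: real). \<forall>\<epsilon> :: real. 0 < \<epsilon> \<and> \<epsilon> \<le> 0.0001 \<longrightarrow>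
            (\<exists>g :: real \<Rightarrow> real^2.
               simple_closed_curve g \<and>
               dilation g \<le> ereal ((1 + \<epsilon>) * (pi / 2)) \<and>
               \<not> enclosed_in_ring g (1 + c * sqrt \<epsilon>)))"
proof (intro conjI allI impI)
  show "enclosed_in_ring g (1 + 3 * sqrt \<epsilon>)"
    if "simple_closed_curve g \<and> 0 \<le> \<epsilon> \<and> \<epsilon> \<le> 0.0001 \<and> dilation g \<le> ereal ((1 + \<epsilon>) * (pi / 2))"
    for g :: "real \<Rightarrow> real^2" and \<epsilon> :: real
    using that enclosed_in_ring_of_dilation_le by blast
next
  show "\<exists>c > (0 :: real). \<forall>\<epsilon> :: real. 0 < \<epsilon> \<and> \<epsilon> \<le> 0.0001 \<longrightarrow>
      (\<exists>g :: real \<Rightarrow> real^2. simple_closed_curve g \<and>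
         dilation g \<le> ereal ((1 + \<epsilon>) * (pi / 2)) \<and> \<not> enclosed_in_ring g (1 + c * sqrt \<epsilon>))"
  \<comment> \<open>To first order in \<open>s = sqrt \<epsilon>\<close> the obstruction works for
    any coefficient below \<open>3/4\<close>; \<open>1/2\<close> leaves room for the error
    terms.\<close>
  proof (intro exI[of _ "1/2"] conjI allI impI)
    fix \<epsilon> :: real
    assume \<epsilon>: "0 < \<epsilon> \<and> \<epsilon> \<le> 0.0001"
    define s where "s = sqrt \<epsilon>"
    have "0 < s" "s\<^sup>2 = \<epsilon>" using \<epsilon> by (simp_all add: s_def)
    have "s \<le> 1/100" unfolding s_def using \<epsilon> by (intro real_le_lsqrt) (auto simp: power2_eq_square)
    show "\<exists>g :: real \<Rightarrow> real^2. simple_closed_curve g \<and>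
        dilation g \<le> ereal ((1 + \<epsilon>) * (pi / 2)) \<and> \<not> enclosed_in_ring g (1 + 1/2 * sqrt \<epsilon>)"
      using simple_closed_wobble_curve[of s] dilation_wobble_curve_le[of s]
        wobble_curve_not_enclosed[of s] \<open>0 < s\<close> \<open>s \<le> 1/100\<close> \<open>s\<^sup>2 = \<epsilon>\<close>
      unfolding s_def[symmetric] by (intro exI[of _ "wobble_curve s"]) simp
  qed simp
qed

end
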